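(* Let $p\in[1,2]$ and $q\in[-1,0)$, and let $$s\ge \min\left\{\frac{1}{p-1},\ \frac{1}{1+q}\right\},$$ with the conventions $\frac{1}{p-1}=+\infty$ if $p=1$ and $\frac{1}{1+q}=+\infty$ if $q=-1$. Then for every $n$, the map $(A,B)\mapsto\Phi_{p,q,s}(A,B)=\mathrm{Tr}[(A^{q/2}B^pA^{q/2})^s]$ is jointly convex on $\mathcal{P}_n\times\mathcal{P}_n$.
   Context: $\mathcal{P}_n$ denotes the set of $n\times n$ positive definite complex matrices; $\Phi_{p,q,s}(A,B)=\mathrm{Tr}[(A^{q/2}B^pA^{q/2})^s]$. *)

theory Defs
  imports "Jordan_Normal_Form.Schur_Decomposition"
begin

definition mtrace :: "complex mat \<Rightarrow> complex" where
  "mtrace A = (\<Sum>i<dim_row A. A $$ (i,i))"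

definition hermitian :: "complex mat \<Rightarrow> bool" where
  "hermitian A \<longleftrightarrow> mat_adjoint A = A"

definition pos_def :: "nat \<Rightarrow> complex mat \<Rightarrow> bool" where
  "pos_def n A \<longleftrightarrow> A \<in> carrier_mat n n \<and> hermitian A \<and>
     (\<forall>v \<in> carrier_vec n. v \<noteq> 0\<^sub>v n \<longrightarrow> Re (conjugate v \<bullet> (A *\<^sub>v v)) > 0)"

definition unitary :: "nat \<Rightarrow> complex mat \<Rightarrow> bool" where
  "unitary n U \<longleftrightarrow> U \<in> carrier_mat n n \<and> mat_adjoint U * U = 1\<^sub>m n"

definition diag_of :: "nat \<Rightarrow> (nat \<Rightarrow> real) \<Rightarrow> complex mat" where
  "diag_of n d = mat n n (\<lambda>(i,j). if i = j then complex_of_real (d i) else 0)"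

text \<open>Real power of a positive definite matrix via its spectral decomposition
  A = U diag(d) U^*, with U unitary and d > 0:  A^r = U diag(d^r) U^*.
  (The result is independent of the chosen decomposition.)\<close>
definition mpowr :: "complex mat \<Rightarrow> real \<Rightarrow> complex mat" where
  "mpowr A r = (let n = dim_row A;
       (U, d) = (SOME (U, d). unitary n U \<and> (\<forall>i<n. d i > 0) \<and>
                              A = U * diag_of n d * mat_adjoint U)
     in U * diag_of n (\<lambda>i. d i powr r) * mat_adjoint U)"

text \<open>Phi_{p,q,s}(A,B) = Tr[(A^{q/2} B^p A^{q/2})^s] (real-valued for A, B positive definite).\<close>
definition Phi :: "real \<Rightarrow> real \<Rightarrow> real \<Rightarrow> complex mat \<Rightarrow> complex mat \<Rightarrow> real" where
  "Phi p q s A B = Re (mtrace (mpowr (mpowr A (q/2) * mpowr B p * mpowr A (q/2)) s))"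

end

(*  Write a = -q > 0 and M = A^(-a/2) B^p A^(-a/2).  Young's inequality makes Tr M^s the maximum over
    positive V of s Tr (M V^(1 - 1/s)) - (s - 1) Tr V.  Parametrising V through a positive matrix R that is
    kept fixed when (A, B) varies, the functional becomes either

      s Tr (R B^p R (R A^a R)^(-1/s)) - (s - 1) Tr (R A^a R)           (used if 1/s <= p - 1), or
      s Tr (R B^p R) - (s - 1) Tr ((R A^a R)^k),  k = s / (s - 1)      (used if 1/s <= 1 - a),

    which is jointly convex in (A, B) by Ando's convexity theorem, respectively by Lieb's concavity theorem
    (in the form of Epstein's); a supremum of convex functions is convex.  Both theorems come from
    x^a z^(1-a) being a positive combination of the parallel sums x z / (x + l z), l > 0, each of which is a
    minimum of functions linear in (x, z).  *)

theory Submission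
  imports
    "HOL-Analysis.Equivalence_Lebesgue_Henstock_Integration"
    "Jordan_Normal_Form.Spectral_Radius"
    Defs
begin

text \<open>The maximising V depends on A and B in an intractable way, so R has to be a parameter
  such that, at fixed R, A enters only through R A^a R, which is operator concave in A. Put C = R
  A^(a/2) and build V from C* C: the outer factors A^(a/2) cancel the A^(-a/2) in M, and polar
  decomposition moves powers from C* C to C C* = R A^a R. For given A every positive V arises from
  some R, so the supremum is unchanged.

  The bounds on s arise because Lieb and Ando require two exponents with sum 1. In the first case (R
  A^a R)^(-1/s) is read as Z^(1 - p) with Z = (R A^a R)^th, th = 1 / (s (p - 1)); in the second, 1/s
  is split as th (1 - a) with th = 1 / (s (1 - a)). Operator concavity of the power th asks for th
  <= 1, which is the hypothesis on s.

  Such Z are concave, not affine, in A. Hence \<open>mix_le\<close>: concavity is proved for all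
  triples with t Z1 + (1 - t) Z2 <= Z, so that operator concave functions can be nested with
  monotonicity built in.\<close>

no_notation Finite_Cartesian_Product.vec.vec_nth (infixl \<open>$\<close> 90)
no_notation inner (infix \<open>\<bullet>\<close> 70)

subsection \<open>Spectral theorem\<close>

lemma mat_adjoint_dims [simp]:
  "dim_row (mat_adjoint A) = dim_col A" "dim_col (mat_adjoint A) = dim_row A"
  by (auto simp: mat_adjoint_def)

lemma mat_adjoint_index [simp]:
  fixes A :: "complex mat"
  shows "i < dim_col A \<Longrightarrow> j < dim_row A \<Longrightarrow> mat_adjoint A $$ (i, j) = cnj (A $$ (j, i))"
  by (simp add: mat_adjoint_def mat_of_rows_index)

lemma mat_adjoint_mat_adjoint [simp]:
  fixes A :: "complex mat"
  shows "mat_adjoint (mat_adjoint A) = A"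
  by (intro eq_matI) auto

lemma mat_adjoint_one [simp]: "mat_adjoint (1\<^sub>m n :: complex mat) = 1\<^sub>m n"
  by (intro eq_matI) auto

lemma diag_of_dims [simp]:
  "dim_row (diag_of n d) = n" "dim_col (diag_of n d) = n" "diag_of n d \<in> carrier_mat n n"
  by (auto simp: diag_of_def)

lemma diag_of_index [simp]:
  "i < n \<Longrightarrow> j < n \<Longrightarrow> diag_of n d $$ (i, j) = (if i = j then of_real (d i) else 0)"
  by (simp add: diag_of_def)

lemma mat_adjoint_diag_of [simp]: "mat_adjoint (diag_of n d) = diag_of n d"
  by (intro eq_matI) auto

lemma diag_of_cong: "(\<And>i. i < n \<Longrightarrow> d i = e i) \<Longrightarrow> diag_of n d = diag_of n e"
  by (intro eq_matI) auto

lemma diag_of_one: "diag_of n (\<lambda>_. 1) = 1\<^sub>m n"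
  by (intro eq_matI) auto

locale square_mats =
  fixes n :: nat
begin

abbreviation M :: "complex mat set" where "M \<equiv> carrier_mat n n"

lemma mult_closed [simp]: "A \<in> M \<Longrightarrow> B \<in> M \<Longrightarrow> A * B \<in> M"
  by (rule mult_carrier_mat)

lemma adjoint_closed [simp]: "A \<in> M \<Longrightarrow> mat_adjoint A \<in> M"
  by auto

lemma mult_assoc: "A \<in> M \<Longrightarrow> B \<in> M \<Longrightarrow> C \<in> M \<Longrightarrow> (A * B) * C = A * (B * C)"
  by (rule assoc_mult_mat)

lemma mult_one [simp]: "A \<in> M \<Longrightarrow> A * 1\<^sub>m n = A" "A \<in> M \<Longrightarrow> 1\<^sub>m n * A = A"
  by auto

text \<open>Where this rule is to act, \<open>index_mult_mat(1)\<close> is deleted from the simpset,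
  as it would first turn the entry into a scalar product of a row and a column.\<close>

lemma mult_index:
  assumes "A \<in> M" "B \<in> M" "i < n" "j < n"
  shows "(A * B) $$ (i, j) = (\<Sum>k<n. A $$ (i, k) * B $$ (k, j))"
  using assms by (simp add: scalar_prod_def atLeast0LessThan)

lemma diag_of_mult_index:
  assumes "A \<in> M" "i < n" "j < n"
  shows "(diag_of n d * A) $$ (i, j) = of_real (d i) * A $$ (i, j)"
    and "(A * diag_of n d) $$ (i, j) = A $$ (i, j) * of_real (d j)"
proof -
  have "(diag_of n d * A) $$ (i, j) = (\<Sum>k<n. if k = i then of_real (d i) * A $$ (i, j) else 0)"
    using assms by (subst mult_index, (simp_all)[4]) (rule sum.cong, auto)
  then show "(diag_of n d * A) $$ (i, j) = of_real (d i) * A $$ (i, j)"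
    using assms by simp
  have "(A * diag_of n d) $$ (i, j) = (\<Sum>k<n. if k = j then A $$ (i, j) * of_real (d j) else 0)"
    using assms by (subst mult_index, (simp_all)[4]) (rule sum.cong, auto)
  then show "(A * diag_of n d) $$ (i, j) = A $$ (i, j) * of_real (d j)"
    using assms by simp
qed

lemma adjoint_mult:
  assumes "A \<in> M" "B \<in> M"
  shows "mat_adjoint (A * B) = mat_adjoint B * mat_adjoint A"
proof (intro eq_matI)
  fix i j assume ij: "i < dim_row (mat_adjoint B * mat_adjoint A)" "j < dim_col (mat_adjoint B * mat_adjoint A)"
  then have "i < n" "j < n" using assms by auto
  moreover have "cnj ((A * B) $$ (j, i)) = (\<Sum>k<n. cnj (A $$ (j, k)) * cnj (B $$ (k, i)))"
    using assms calculation by (simp add: mult_index del: index_mult_mat(1))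
  moreover have "(mat_adjoint B * mat_adjoint A) $$ (i, j) = (\<Sum>k<n. cnj (B $$ (k, i)) * cnj (A $$ (j, k)))"
    using assms calculation by (simp add: mult_index del: index_mult_mat(1))
  ultimately show "mat_adjoint (A * B) $$ (i, j) = (mat_adjoint B * mat_adjoint A) $$ (i, j)"
    using assms by (simp add: mult.commute del: index_mult_mat(1))
qed (use assms in auto)

lemma adjoint_add:
  assumes "A \<in> M" "B \<in> M"
  shows "mat_adjoint (A + B) = mat_adjoint A + mat_adjoint B"
  using assms by (intro eq_matI) auto

lemma adjoint_smult:
  assumes "A \<in> M"
  shows "mat_adjoint (c \<cdot>\<^sub>m A) = cnj c \<cdot>\<^sub>m mat_adjoint A"
  using assms by (intro eq_matI) auto

lemma mtrace_add: "A \<in> M \<Longrightarrow> B \<in> M \<Longrightarrow> mtrace (A + B) = mtrace A + mtrace B"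
  by (auto simp: mtrace_def sum.distrib)

lemma mtrace_smult: "A \<in> M \<Longrightarrow> mtrace (c \<cdot>\<^sub>m A) = c * mtrace A"
  by (auto simp: mtrace_def sum_distrib_left)

lemma mtrace_comm:
  assumes "A \<in> M" "B \<in> M"
  shows "mtrace (A * B) = mtrace (B * A)"
proof -
  have "mtrace (A * B) = (\<Sum>i<n. \<Sum>k<n. A $$ (i, k) * B $$ (k, i))"
    using assms by (simp add: mtrace_def mult_index del: index_mult_mat(1))
  also have "\<dots> = (\<Sum>k<n. \<Sum>i<n. B $$ (k, i) * A $$ (i, k))"
    by (subst sum.swap) (simp add: mult.commute)
  also have "\<dots> = mtrace (B * A)"
    using assms by (simp add: mtrace_def mult_index del: index_mult_mat(1))
  finally show ?thesis .
qed

lemma unitaryD: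
  assumes "unitary n U"
  shows "U \<in> M" "mat_adjoint U * U = 1\<^sub>m n" "U * mat_adjoint U = 1\<^sub>m n"
proof -
  show U: "U \<in> M" "mat_adjoint U * U = 1\<^sub>m n" using assms by (auto simp: unitary_def)
  then show "U * mat_adjoint U = 1\<^sub>m n"
    by (metis adjoint_closed mat_mult_left_right_inverse)
qed

lemma unitary_cancel:
  assumes "unitary n U" "A \<in> M"
  shows "mat_adjoint U * (U * A) = A" "U * (mat_adjoint U * A) = A"
  using assms unitaryD[OF assms(1)] by (simp_all flip: mult_assoc)

lemma unitary_mult:
  assumes "unitary n U" "unitary n V"
  shows "unitary n (U * V)"
  using unitaryD[OF assms(1)] unitaryD[OF assms(2)]
  by (simp add: unitary_def adjoint_mult mult_assoc unitary_cancel[OF assms(1)])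

text \<open>Gram-Schmidt makes a basis starting with \<open>v\<close> orthogonal and keeps its first
  vector; normalised, it gives the columns of a unitary matrix. With an eigenvector as
  \<open>v\<close> this is the deflation step of the spectral theorem.\<close>

lemma ex_unitary_first_column:
  assumes v: "v \<in> carrier_vec n" "v \<noteq> 0\<^sub>v n"
  shows "\<exists>W c. unitary n W \<and> col W 0 = c \<cdot>\<^sub>v v"
proof -
  have "n \<noteq> 0" using v by auto
  interpret cof_vec_space n "TYPE(complex)" .
  define b where "b = basis_completion v"
  define ws where "ws = gram_schmidt n b"
  from basis_completion[OF v, folded b_def]
  have dist_b: "distinct b" and indep: "\<not> lin_dep (set b)" and b: "set b \<subseteq> carrier_vec n"
    and hdb: "hd b = v" and len_b: "length b = n" by auto
  from hdb len_b \<open>n \<noteq> 0\<close> obtain vs where bv: "b = v # vs" by (cases b, auto)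
  from gram_schmidt_result[OF b dist_b indep refl, folded ws_def]
  have ws: "set ws \<subseteq> carrier_vec n" "corthogonal ws" "length ws = n" by (auto simp: len_b)
  from gram_schmidt_hd[OF v(1), of vs, folded bv] have hdws: "hd ws = v" unfolding ws_def .
  have ws0: "ws ! 0 = v" using hdws ws(3) \<open>n \<noteq> 0\<close> by (cases ws) auto
  have wsc: "ws ! i \<in> carrier_vec n" if "i < n" for i using ws that by auto
  \<comment> \<open>\<open>corthogonal\<close> means orthogonal and nonzero but not of length one,
    so the squared lengths \<open>N i\<close> must be divided out.\<close>
  define N where "N i = (\<Sum>k<n. (cmod (ws ! i $ k))\<^sup>2)" for i
  have orth: "(\<Sum>k<n. cnj (ws ! i $ k) * ws ! j $ k) = (if i = j then of_real (N i) else 0)"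
    if "i < n" "j < n" for i j
  proof (cases "i = j")
    case True
    then show ?thesis
      by (simp add: N_def complex_norm_square mult.commute del: of_real_power)
  next
    case False
    have "ws ! j \<bullet>c ws ! i = 0" using corthogonalD[OF ws(2), of j i] that ws(3) False by auto
    then show ?thesis using False wsc[OF that(1)] wsc[OF that(2)]
      by (simp add: scalar_prod_def atLeast0LessThan mult.commute)
  qed
  have N: "N i > 0" if "i < n" for i
  proof -
    have "ws ! i \<bullet>c ws ! i \<noteq> 0" using corthogonalD[OF ws(2), of i i] that ws(3) by auto
    then have "of_real (N i) \<noteq> (0::complex)" using orth[OF that that] wsc[OF that]
      by (simp add: scalar_prod_def atLeast0LessThan mult.commute)
    then have "N i \<noteq> 0" by simp
    moreover have "N i \<ge> 0" by (simp add: N_def sum_nonneg)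
    ultimately show ?thesis by linarith
  qed
  define W where "W = mat n n (\<lambda>(i, j). ws ! j $ i / of_real (sqrt (N j)))"
  have W: "W \<in> M" by (simp add: W_def)
  have "mat_adjoint W * W = 1\<^sub>m n"
  proof (intro eq_matI)
    fix i j assume "i < dim_row (1\<^sub>m n :: complex mat)" "j < dim_col (1\<^sub>m n :: complex mat)"
    then have ij: "i < n" "j < n" by auto
    have "(mat_adjoint W * W) $$ (i, j)
        = (\<Sum>k<n. cnj (ws ! i $ k) * ws ! j $ k) / of_real (sqrt (N i) * sqrt (N j))"
      using ij W by (subst mult_index) (auto simp: W_def sum_divide_distrib)
    also have "\<dots> = (1\<^sub>m n) $$ (i, j)"
      using ij N[of i] by (cases "i = j") (simp_all add: orth flip: of_real_mult)
    finally show "(mat_adjoint W * W) $$ (i, j) = (1\<^sub>m n) $$ (i, j)" .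
  qed (use W in auto)
  then have "unitary n W" using W by (simp add: unitary_def)
  moreover have "col W 0 = (1 / of_real (sqrt (N 0))) \<cdot>\<^sub>v v"
    using \<open>n \<noteq> 0\<close> v(1) ws0 by (intro eq_vecI) (auto simp: W_def)
  ultimately show ?thesis by blast
qed

abbreviation spec :: "complex mat \<Rightarrow> (nat \<Rightarrow> real) \<Rightarrow> complex mat" where
  "spec U d \<equiv> U * diag_of n d * mat_adjoint U"

lemma spec_index:
  assumes "U \<in> M" "i < n" "j < n"
  shows "spec U d $$ (i, j) = (\<Sum>k<n. U $$ (i, k) * of_real (d k) * cnj (U $$ (j, k)))"
proof -
  show ?thesis using assms by (subst mult_index) (auto simp: diag_of_mult_index simp del: index_mult_mat(1))
qed

end

text \<open>Deflation: in a unitary basis that starts with an eigenvector, the matrix splits into a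
  real 1 by 1 block and a hermitian block of size \<open>n\<close>, to which the induction
  hypothesis applies.\<close>

lemma hermitian_spectral:
  assumes "A \<in> carrier_mat n n" "hermitian A"
  shows "\<exists>U d. unitary n U \<and> A = U * diag_of n d * mat_adjoint U"
  using assms
proof (induction n arbitrary: A)
  case 0
  show ?case
    by (rule exI[of _ "1\<^sub>m 0"], rule exI[of _ "\<lambda>_. 0"]) (use 0 in \<open>auto simp: unitary_def intro!: eq_matI\<close>)
next
  case (Suc n)
  interpret S: square_mats "Suc n" .
  interpret I: square_mats n .
  note A = Suc.prems(1)
  obtain e where "eigenvalue A e"
    using spectrum_non_empty[OF A] by (auto simp: spectrum_def)
  then obtain v where v: "v \<in> carrier_vec (Suc n)" "v \<noteq> 0\<^sub>v (Suc n)" "A *\<^sub>v v = e \<cdot>\<^sub>v v"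
    using A unfolding eigenvalue_def eigenvector_def by auto
  obtain W c where W: "unitary (Suc n) W" "col W 0 = c \<cdot>\<^sub>v v"
    using S.ex_unitary_first_column[OF v(1,2)] by blast
  note WD = S.unitaryD[OF W(1)]
  have WA: "(A * W) $$ (k, 0) = e * W $$ (k, 0)" if "k < Suc n" for k
  proof -
    have "(A * W) $$ (k, 0) = (A *\<^sub>v col W 0) $ k" using A WD(1) that by simp
    also have "A *\<^sub>v col W 0 = c \<cdot>\<^sub>v (A *\<^sub>v v)" using W(2) A v by (simp add: mult_mat_vec)
    also have "\<dots> = e \<cdot>\<^sub>v col W 0" using v by (simp add: W(2) smult_smult_assoc mult.commute)
    finally show ?thesis using A WD(1) that by simp
  qed
  define B where "B = mat_adjoint W * (A * W)"
  have B: "B \<in> carrier_mat (Suc n) (Suc n)" using A WD by (simp add: B_def)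
  have Bh: "mat_adjoint B = B"
    using A WD Suc.prems(2) by (simp add: B_def S.adjoint_mult hermitian_def S.mult_assoc)
  have Bij: "cnj (B $$ (i, j)) = B $$ (j, i)" if "i < Suc n" "j < Suc n" for i j
    using arg_cong[OF Bh, of "\<lambda>X. X $$ (j, i)"] B that by simp
  have B0: "B $$ (i, 0) = (if i = 0 then e else 0)" if i: "i < Suc n" for i
  proof -
    have "B $$ (i, 0) = (\<Sum>k<Suc n. mat_adjoint W $$ (i, k) * (e * W $$ (k, 0)))"
      unfolding B_def using A WD i by (subst S.mult_index) (auto simp: WA simp del: index_mult_mat(1))
    also have "\<dots> = e * (mat_adjoint W * W) $$ (i, 0)"
      using WD i by (subst S.mult_index) (auto simp: sum_distrib_left mult_ac simp del: sum.lessThan_Suc)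
    finally show ?thesis using i unfolding WD by simp
  qed
  \<comment> \<open>The diagonal entries of the hermitian \<open>B\<close> are real, so the
    eigenvalue can be stored in the real sequence \<open>d'\<close>.\<close>
  have e: "e = of_real (Re e)"
    using Bij[of 0 0] B0[of 0] by (simp add: complex_eq_iff)
  define C where "C = mat n n (\<lambda>(i, j). B $$ (Suc i, Suc j))"
  have "C \<in> carrier_mat n n" by (simp add: C_def)
  moreover have "hermitian C"
    unfolding hermitian_def by (intro eq_matI) (auto simp: C_def Bij)
  ultimately obtain V d where V: "unitary n V" and CV: "C = V * diag_of n d * mat_adjoint V"
    using Suc.IH by blast
  note VD = I.unitaryD[OF V]
  \<comment> \<open>The block sum of 1 and \<open>V\<close>, which diagonalises
    \<open>B\<close>.\<close>
  define U where "U = mat (Suc n) (Suc n) (\<lambda>(i, j). case (i, j) of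
      (0, 0) \<Rightarrow> 1 | (0, Suc _) \<Rightarrow> 0 | (Suc _, 0) \<Rightarrow> 0 | (Suc i, Suc j) \<Rightarrow> V $$ (i, j))"
  define d' where "d' = case_nat (Re e) d"
  have U: "U \<in> carrier_mat (Suc n) (Suc n)" by (simp add: U_def)
  have "mat_adjoint U * U = 1\<^sub>m (Suc n)"
  proof (intro eq_matI)
    fix i j assume "i < dim_row (1\<^sub>m (Suc n) :: complex mat)" "j < dim_col (1\<^sub>m (Suc n) :: complex mat)"
    then have ij: "i < Suc n" "j < Suc n" by auto
    have *: "(\<Sum>k<n. cnj (V $$ (k, i)) * V $$ (k, j)) = (if i = j then 1 else 0)"
      if "i < n" "j < n" for i j
      using arg_cong[OF VD(2), of "\<lambda>X. X $$ (i, j)"] that VD(1)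
      by (subst (asm) I.mult_index) auto
    show "(mat_adjoint U * U) $$ (i, j) = (1\<^sub>m (Suc n)) $$ (i, j)"
      using ij U by (subst S.mult_index, (simp_all)[4], cases i; cases j)
        (simp_all add: U_def sum.lessThan_Suc_shift * del: sum.lessThan_Suc)
  qed (use U in auto)
  then have U': "unitary (Suc n) U" using U by (simp add: unitary_def)
  have BU: "B = U * diag_of (Suc n) d' * mat_adjoint U"
  proof (intro eq_matI)
    fix i j assume "i < dim_row (U * diag_of (Suc n) d' * mat_adjoint U)"
      "j < dim_col (U * diag_of (Suc n) d' * mat_adjoint U)"
    then have ij: "i < Suc n" "j < Suc n" using U by auto
    have BC: "B $$ (Suc i, Suc j) = (\<Sum>k<n. V $$ (i, k) * of_real (d k) * cnj (V $$ (j, k)))"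
      if "i < n" "j < n" for i j
      using arg_cong[OF CV, of "\<lambda>X. X $$ (i, j)"] that VD(1)
      by (subst (asm) I.spec_index) (auto simp: C_def)
    \<comment> \<open>Hermitian symmetry carries the zeros of the first column over to the first
      row.\<close>
    have Bj: "B $$ (0, Suc j) = 0" if "j < n" for j
      using Bij[of "Suc j" 0] B0[of "Suc j"] that by simp
    show "B $$ (i, j) = (U * diag_of (Suc n) d' * mat_adjoint U) $$ (i, j)"
      using ij e[symmetric] by (subst S.spec_index[OF U], (simp_all)[2], cases i; cases j)
        (simp_all add: U_def d'_def sum.lessThan_Suc_shift BC B0 Bj del: sum.lessThan_Suc)
  qed (use U B in auto)
  have "A = W * B * mat_adjoint W"
    using A WD by (simp add: B_def S.mult_assoc S.unitary_cancel[OF W(1)])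
  also have "\<dots> = (W * U) * diag_of (Suc n) d' * mat_adjoint (W * U)"
    unfolding BU using WD U by (simp add: S.mult_assoc S.adjoint_mult)
  finally show ?case using S.unitary_mult[OF W(1) U'] by blast
qed

context square_mats
begin

subsection \<open>Positive definite matrices and their powers\<close>

lemma mult_mat_vec_closed [simp]: "A \<in> M \<Longrightarrow> v \<in> carrier_vec n \<Longrightarrow> A *\<^sub>v v \<in> carrier_vec n"
  by (rule mult_mat_vec_carrier)

lemma mult_mat_vec_zero [simp]: "A \<in> M \<Longrightarrow> A *\<^sub>v 0\<^sub>v n = 0\<^sub>v n"
  by (intro eq_vecI) auto

lemma smult_mult_mat_vec: "A \<in> M \<Longrightarrow> v \<in> carrier_vec n \<Longrightarrow> (c \<cdot>\<^sub>m A) *\<^sub>v v = c \<cdot>\<^sub>v (A *\<^sub>v v)"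
  by (intro eq_vecI) (auto simp: scalar_prod_def sum_distrib_left mult.assoc)

lemma scalar_prod_adjoint:
  assumes "C \<in> M" "v \<in> carrier_vec n" "x \<in> carrier_vec n"
  shows "conjugate v \<bullet> (mat_adjoint C *\<^sub>v x) = conjugate (C *\<^sub>v v) \<bullet> x"
proof -
  have "conjugate v \<bullet> (mat_adjoint C *\<^sub>v x) = (\<Sum>i<n. \<Sum>k<n. cnj (v $ i) * (cnj (C $$ (k, i)) * x $ k))"
    using assms by (simp add: scalar_prod_def atLeast0LessThan sum_distrib_left)
  also have "\<dots> = (\<Sum>k<n. \<Sum>i<n. cnj (v $ i) * (cnj (C $$ (k, i)) * x $ k))"
    by (rule sum.swap)
  also have "\<dots> = conjugate (C *\<^sub>v v) \<bullet> x"
    using assms by (simp add: scalar_prod_def atLeast0LessThan sum_distrib_left sum_distrib_right mult_ac)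
  finally show ?thesis .
qed

lemma scalar_prod_congruence:
  assumes "A \<in> M" "C \<in> M" "v \<in> carrier_vec n"
  shows "conjugate v \<bullet> ((mat_adjoint C * A * C) *\<^sub>v v) = conjugate (C *\<^sub>v v) \<bullet> (A *\<^sub>v (C *\<^sub>v v))"
proof -
  have "(mat_adjoint C * A * C) *\<^sub>v v = mat_adjoint C *\<^sub>v (A *\<^sub>v (C *\<^sub>v v))"
    using assms by (simp add: mult_assoc assoc_mult_mat_vec[of _ n n _ n])
  then show ?thesis using assms by (simp add: scalar_prod_adjoint)
qed

lemma scalar_prod_diag_of:
  assumes "v \<in> carrier_vec n"
  shows "conjugate v \<bullet> (diag_of n d *\<^sub>v v) = of_real (\<Sum>k<n. d k * (cmod (v $ k))\<^sup>2)"
proof -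
  have "(diag_of n d *\<^sub>v v) $ i = of_real (d i) * v $ i" if "i < n" for i
    using assms that by (simp add: scalar_prod_def atLeast0LessThan if_distrib if_distribR sum.delta cong: if_cong)
  then have "conjugate v \<bullet> (diag_of n d *\<^sub>v v) = (\<Sum>k<n. cnj (v $ k) * (of_real (d k) * v $ k))"
    using assms by (simp add: scalar_prod_def atLeast0LessThan)
  then show ?thesis by (simp add: complex_norm_square mult_ac del: of_real_power)
qed

lemma unitary_spec_mult:
  assumes "unitary n U"
  shows "spec U d * spec U e = spec U (\<lambda>i. d i * e i)"
proof -
  have D: "diag_of n d * diag_of n e = diag_of n (\<lambda>i. d i * e i)"
    by (intro eq_matI) (auto simp: diag_of_mult_index simp del: index_mult_mat(1))
  then have *: "diag_of n d * (diag_of n e * X) = diag_of n (\<lambda>i. d i * e i) * X" if "X \<in> M" for X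
    using mult_assoc[of "diag_of n d" "diag_of n e" X] that by (simp add: D)
  show ?thesis using unitaryD[OF assms] by (simp add: mult_assoc unitary_cancel[OF assms] *)
qed

lemma spec_adjoint: "U \<in> M \<Longrightarrow> mat_adjoint (spec U d) = spec U d"
  by (simp add: adjoint_mult mult_assoc)

lemma spec_one: "unitary n U \<Longrightarrow> spec U (\<lambda>_. 1) = 1\<^sub>m n"
  using unitaryD[of U] by (simp add: diag_of_one)

lemma spec_cong: "(\<And>i. i < n \<Longrightarrow> d i = e i) \<Longrightarrow> spec U d = spec U e"
  using diag_of_cong[of n d e] by simp

lemma pos_def_spec:
  assumes U: "unitary n U" and d: "\<And>i. i < n \<Longrightarrow> d i > 0"
  shows "pos_def n (spec U d)"
  unfolding pos_def_def hermitian_def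
proof (intro conjI ballI impI)
  note UD = unitaryD[OF U]
  show "spec U d \<in> M" using UD by simp
  show "mat_adjoint (spec U d) = spec U d" using UD by (simp add: spec_adjoint)
  fix v :: "complex vec" assume v: "v \<in> carrier_vec n" "v \<noteq> 0\<^sub>v n"
  define w where "w = mat_adjoint U *\<^sub>v v"
  have w: "w \<in> carrier_vec n" using UD v by (simp add: w_def)
  have "v = U *\<^sub>v w"
    using UD v by (simp add: w_def assoc_mult_mat_vec[of _ n n _ n, symmetric])
  then have "w \<noteq> 0\<^sub>v n" using v UD by auto
  then obtain k where k: "k < n" "w $ k \<noteq> 0" using w by (metis carrier_vecD eq_vecI index_zero_vec)
  have "Re (conjugate v \<bullet> (spec U d *\<^sub>v v)) = (\<Sum>k<n. d k * (cmod (w $ k))\<^sup>2)"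
    using scalar_prod_congruence[of "diag_of n d" "mat_adjoint U" v] UD v w
    by (simp add: scalar_prod_diag_of flip: w_def)
  also have "\<dots> > 0"
    using k d by (intro sum_pos2[of _ k]) (auto simp: less_imp_le)
  finally show "Re (conjugate v \<bullet> (spec U d *\<^sub>v v)) > 0" .
qed

text \<open>The eigenvalue \<open>d i\<close> is the value of the quadratic form at column
  \<open>i\<close> of \<open>U\<close>, which \<open>mat_adjoint U\<close> sends to a unit
  vector.\<close>

lemma pos_def_spectral:
  assumes "pos_def n A"
  obtains U d where "unitary n U" "\<And>i. i < n \<Longrightarrow> d i > 0" "A = spec U d"
proof -
  from assms have A: "A \<in> M" "hermitian A"
    and pos: "\<And>v. v \<in> carrier_vec n \<Longrightarrow> v \<noteq> 0\<^sub>v n \<Longrightarrow> Re (conjugate v \<bullet> (A *\<^sub>v v)) > 0"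
    by (auto simp: pos_def_def)
  from hermitian_spectral[OF A] obtain U d where U: "unitary n U" and Ad: "A = spec U d" by blast
  note UD = unitaryD[OF U]
  have "d i > 0" if i: "i < n" for i
  proof -
    let ?v = "col U i"
    have w: "mat_adjoint U *\<^sub>v ?v = unit_vec n i"
    proof -
      have "mat_adjoint U *\<^sub>v ?v = col (mat_adjoint U * U) i" using UD(1) i by (simp add: col_mult2[of _ n n _ n])
      then show ?thesis using i by (simp add: UD)
    qed
    have v: "?v \<in> carrier_vec n" using UD(1) i by simp
    have "?v \<noteq> 0\<^sub>v n"
    proof
      assume "?v = 0\<^sub>v n"
      then have "mat_adjoint U *\<^sub>v ?v = 0\<^sub>v n" using UD(1) by (intro eq_vecI) auto
      then have "unit_vec n i = (0\<^sub>v n :: complex vec)" using w by simp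
      then have "unit_vec n i $ i = (0\<^sub>v n :: complex vec) $ i" by simp
      then show False using i by simp
    qed
    then have "0 < Re (conjugate ?v \<bullet> (A *\<^sub>v ?v))" using pos v by blast
    also have "\<dots> = (\<Sum>k<n. d k * (cmod (unit_vec n i $ k))\<^sup>2)"
      using scalar_prod_congruence[of "diag_of n d" "mat_adjoint U" ?v] UD v w Ad
      by (simp add: scalar_prod_diag_of)
    also have "\<dots> = d i"
      using i by (simp add: unit_vec_def if_distrib if_distribR sum.delta cong: if_cong)
    finally show ?thesis .
  qed
  with U Ad that show ?thesis by blast
qed

lemma pos_def_closed [simp]: "pos_def n A \<Longrightarrow> A \<in> M"
  by (simp add: pos_def_def)

lemma pos_def_adjoint: "pos_def n A \<Longrightarrow> mat_adjoint A = A"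
  by (simp add: pos_def_def hermitian_def)

lemma pos_def_one: "pos_def n (1\<^sub>m n)"
  using pos_def_spec[of "1\<^sub>m n" "\<lambda>_. 1"] by (simp add: unitary_def diag_of_one)

lemma pos_def_convex:
  assumes A: "pos_def n A" and B: "pos_def n B" and t: "0 \<le> t" "t \<le> 1"
  shows "pos_def n (complex_of_real t \<cdot>\<^sub>m A + complex_of_real (1 - t) \<cdot>\<^sub>m B)"
  unfolding pos_def_def hermitian_def
proof (intro conjI ballI impI)
  note AB = pos_def_closed[OF A] pos_def_closed[OF B]
  let ?C = "complex_of_real t \<cdot>\<^sub>m A + complex_of_real (1 - t) \<cdot>\<^sub>m B"
  show "?C \<in> M" using AB by simp
  show "mat_adjoint ?C = ?C" using AB pos_def_adjoint[OF A] pos_def_adjoint[OF B]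
    by (simp add: adjoint_add adjoint_smult)
  fix v :: "complex vec" assume v: "v \<in> carrier_vec n" "v \<noteq> 0\<^sub>v n"
  have "?C *\<^sub>v v = complex_of_real t \<cdot>\<^sub>v (A *\<^sub>v v) + complex_of_real (1 - t) \<cdot>\<^sub>v (B *\<^sub>v v)"
    using AB v by (simp add: add_mult_distrib_mat_vec[of _ n n] smult_mult_mat_vec)
  then have "Re (conjugate v \<bullet> (?C *\<^sub>v v)) =
      t * Re (conjugate v \<bullet> (A *\<^sub>v v)) + (1 - t) * Re (conjugate v \<bullet> (B *\<^sub>v v))"
    using AB v by (simp add: scalar_prod_add_distrib[of _ n])
  moreover have "Re (conjugate v \<bullet> (A *\<^sub>v v)) > 0" "Re (conjugate v \<bullet> (B *\<^sub>v v)) > 0"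
    using A B v by (auto simp: pos_def_def)
  ultimately show "Re (conjugate v \<bullet> (?C *\<^sub>v v)) > 0"
    using t by (cases "t = 0") (auto intro!: add_pos_nonneg mult_nonneg_nonneg)
qed

text \<open>The left inverse \<open>D\<close> expresses that \<open>C\<close> is injective, so that
  \<open>C *\<^sub>v v\<close> is nonzero along with \<open>v\<close>.\<close>

lemma pos_def_congruence:
  assumes A: "pos_def n A" and C: "C \<in> M" "D \<in> M" "D * C = 1\<^sub>m n"
  shows "pos_def n (mat_adjoint C * A * C)"
  unfolding pos_def_def hermitian_def
proof (intro conjI ballI impI)
  note AM = pos_def_closed[OF A]
  show "mat_adjoint C * A * C \<in> M" using AM C by simp
  show "mat_adjoint (mat_adjoint C * A * C) = mat_adjoint C * A * C"
    using AM C pos_def_adjoint[OF A] by (simp add: adjoint_mult mult_assoc)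
  fix v :: "complex vec" assume v: "v \<in> carrier_vec n" "v \<noteq> 0\<^sub>v n"
  have "D *\<^sub>v (C *\<^sub>v v) = v"
    using C v by (simp add: assoc_mult_mat_vec[of _ n n _ n, symmetric])
  then have "C *\<^sub>v v \<noteq> 0\<^sub>v n" using v C by auto
  then show "Re (conjugate v \<bullet> ((mat_adjoint C * A * C) *\<^sub>v v)) > 0"
    using A AM C v by (auto simp: scalar_prod_congruence pos_def_def)
qed

section \<open>Real powers: independence of the decomposition and rules of calculation\<close>

text \<open>The unitary \<open>W\<close> intertwines the two diagonal matrices: W_ij d_j = e_i W_ij.
  So d_j = e_i wherever W_ij is nonzero, and the same relation holds with f applied to the
  eigenvalues.\<close>

lemma spec_unique:
  assumes U: "unitary n U" and V: "unitary n V" and eq: "spec U d = spec V e"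
  shows "spec U (\<lambda>i. f (d i)) = spec V (\<lambda>i. f (e i))"
proof -
  note UD = unitaryD[OF U] note VD = unitaryD[OF V]
  note cancel = unitary_cancel[OF U] unitary_cancel[OF V]
  define W where "W = mat_adjoint V * U"
  have W: "W \<in> M" using UD VD by (simp add: W_def)
  have index: "(W * diag_of n d) $$ (i, j) = W $$ (i, j) * of_real (d j)"
    "(diag_of n d * W) $$ (i, j) = of_real (d i) * W $$ (i, j)" if "i < n" "j < n" for i j d
    using that W by (simp_all add: diag_of_mult_index del: index_mult_mat(1))
  have "W * diag_of n d = mat_adjoint V * (spec U d) * U"
    using UD VD by (simp add: W_def mult_assoc cancel)
  also have "\<dots> = diag_of n e * W"
    unfolding eq using UD VD by (simp add: W_def mult_assoc cancel)
  finally have *: "W $$ (i, j) * of_real (d j) = of_real (e i) * W $$ (i, j)" if "i < n" "j < n" for i j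
    using index that by metis
  have "W * diag_of n (\<lambda>i. f (d i)) = diag_of n (\<lambda>i. f (e i)) * W"
  proof (rule eq_matI)
    fix i j assume "i < dim_row (diag_of n (\<lambda>i. f (e i)) * W)" "j < dim_col (diag_of n (\<lambda>i. f (e i)) * W)"
    then have ij: "i < n" "j < n" using W by auto
    show "(W * diag_of n (\<lambda>i. f (d i))) $$ (i, j) = (diag_of n (\<lambda>i. f (e i)) * W) $$ (i, j)"
      using *[OF ij] by (cases "W $$ (i, j) = 0") (auto simp: index[OF ij] mult.commute)
  qed (use W in auto)
  then have "V * (W * diag_of n (\<lambda>i. f (d i))) * mat_adjoint U = V * (diag_of n (\<lambda>i. f (e i)) * W) * mat_adjoint U"
    by simp
  then show ?thesis using UD VD W by (simp add: W_def mult_assoc cancel)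
qed

text \<open>The choice in \<open>mpowr_def\<close> may return a different decomposition, but by
  \<open>spec_unique\<close> with the same result. From here on, powers are computed in any
  convenient eigenbasis.\<close>

lemma mpowr_spec:
  assumes U: "unitary n U" and d: "\<And>i. i < n \<Longrightarrow> d i > 0"
  shows "mpowr (spec U d) r = spec U (\<lambda>i. d i powr r)"
proof -
  define P where "P = (\<lambda>(V, e). unitary n V \<and> (\<forall>i<n. e i > 0) \<and> spec U d = spec V e)"
  define Ve where "Ve = (SOME p. P p)"
  have "P (U, d)" using assms by (auto simp: P_def)
  then have "P Ve" unfolding Ve_def by (rule someI)
  obtain V e where Ve: "Ve = (V, e)" by fastforce
  have V: "unitary n V" "spec U d = spec V e" using \<open>P Ve\<close> by (auto simp: P_def Ve)
  have dim: "dim_row (spec U d) = n" using unitaryD(1)[OF U] by simp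
  have "mpowr (spec U d) r = spec V (\<lambda>i. e i powr r)"
    unfolding mpowr_def Let_def dim using Ve by (simp add: Ve_def P_def case_prod_unfold)
  also have "\<dots> = spec U (\<lambda>i. d i powr r)"
    using spec_unique[OF U V, of "\<lambda>x. x powr r"] by simp
  finally show ?thesis .
qed

lemma mpowr_pos_def:
  assumes "pos_def n A"
  shows "pos_def n (mpowr A r)"
  using pos_def_spectral[OF assms] by (metis mpowr_spec pos_def_spec powr_gt_zero less_numeral_extra(3))

lemma mpowr_closed [simp]: "pos_def n A \<Longrightarrow> mpowr A r \<in> M"
  using mpowr_pos_def by simp

lemma mpowr_adjoint [simp]: "pos_def n A \<Longrightarrow> mat_adjoint (mpowr A r) = mpowr A r"
  by (simp add: mpowr_pos_def pos_def_adjoint)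

lemma mpowr_mult:
  assumes "pos_def n A"
  shows "mpowr A r * mpowr A s = mpowr A (r + s)"
proof -
  obtain U d where "unitary n U" "\<And>i. i < n \<Longrightarrow> d i > 0" "A = spec U d"
    using pos_def_spectral[OF assms] by blast
  then show ?thesis by (simp add: mpowr_spec unitary_spec_mult powr_add)
qed

lemma mpowr_mpowr:
  assumes "pos_def n A"
  shows "mpowr (mpowr A r) s = mpowr A (r * s)"
proof -
  obtain U d where *: "unitary n U" "\<And>i. i < n \<Longrightarrow> d i > 0" "A = spec U d"
    using pos_def_spectral[OF assms] by blast
  show ?thesis using *(1,2) unfolding *(3)
    by (subst mpowr_spec, simp, simp, subst mpowr_spec) (force simp: mpowr_spec powr_powr)+
qed

lemma mpowr_one:
  assumes "pos_def n A"
  shows "mpowr A 1 = A"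
proof -
  obtain U d where *: "unitary n U" "\<And>i. i < n \<Longrightarrow> d i > 0" "A = spec U d"
    using pos_def_spectral[OF assms] by blast
  show ?thesis using *(1,2) unfolding *(3)
    by (subst mpowr_spec) (auto intro!: spec_cong simp: less_imp_le)
qed

lemma mpowr_zero:
  assumes "pos_def n A"
  shows "mpowr A 0 = 1\<^sub>m n"
proof -
  obtain U d where *: "unitary n U" "\<And>i. i < n \<Longrightarrow> d i > 0" "A = spec U d"
    using pos_def_spectral[OF assms] by blast
  have "mpowr A 0 = spec U (\<lambda>_. 1)" using *(1,2) unfolding *(3)
    by (subst mpowr_spec) (force intro!: spec_cong)+
  then show ?thesis using spec_one[OF *(1)] by simp
qed

lemma one_mpowr: "mpowr (1\<^sub>m n) r = 1\<^sub>m n"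
  using mpowr_spec[of "1\<^sub>m n" "\<lambda>_. 1" r] by (simp add: unitary_def diag_of_one)

lemma mpowr_unitary_conjugate:
  assumes "unitary n W" "pos_def n A"
  shows "mpowr (W * A * mat_adjoint W) r = W * mpowr A r * mat_adjoint W"
proof -
  obtain U d where *: "unitary n U" "\<And>i. i < n \<Longrightarrow> d i > 0" "A = spec U d"
    using pos_def_spectral[OF assms(2)] by blast
  have "W * spec U e * mat_adjoint W = spec (W * U) e" for e
    using unitaryD[OF assms(1)] unitaryD[OF *(1)] by (simp add: mult_assoc adjoint_mult)
  then show ?thesis using * mpowr_spec[of "W * U" d r] unitary_mult[OF assms(1) *(1)]
    by (simp add: mpowr_spec)
qed

abbreviation tr :: "complex mat \<Rightarrow> real" where "tr A \<equiv> Re (mtrace A)"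

text \<open>Left and right multiplication commute, so the form in \<open>K\<close> is diagonal in
  the coordinates given by both eigenbases. Trace inequalities in two matrices thereby reduce to
  scalar inequalities for pairs of eigenvalues with nonnegative weights.\<close>

lemma tr_spec:
  assumes U: "unitary n U" and V: "unitary n V" and K: "K \<in> M"
  shows "tr (mat_adjoint K * spec U f * K * spec V g)
    = (\<Sum>i<n. \<Sum>j<n. f i * g j * (cmod ((mat_adjoint U * K * V) $$ (i, j)))\<^sup>2)"
proof -
  note UD = unitaryD[OF U] note VD = unitaryD[OF V]
  define X where "X = mat_adjoint U * K * V"
  have X: "X \<in> M" using UD VD K by (simp add: X_def)
  have "mtrace (mat_adjoint K * spec U f * K * spec V g)
      = mtrace ((mat_adjoint K * spec U f * K * V * diag_of n g) * mat_adjoint V)"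
    using UD VD K by (simp add: mult_assoc)
  also have "\<dots> = mtrace (mat_adjoint V * (mat_adjoint K * spec U f * K * V * diag_of n g))"
    using UD VD K by (subst mtrace_comm) auto
  also have "mat_adjoint V * (mat_adjoint K * spec U f * K * V * diag_of n g)
      = mat_adjoint X * (diag_of n f * (X * diag_of n g))"
    using UD VD K by (simp add: X_def mult_assoc adjoint_mult)
  also have "mtrace \<dots> = (\<Sum>j<n. \<Sum>i<n. cnj (X $$ (i, j)) * (of_real (f i) * (X $$ (i, j) * of_real (g j))))"
  proof -
    have *: "(X * diag_of n g) $$ (i, j) = X $$ (i, j) * of_real (g j)"
      "(diag_of n f * Y) $$ (i, j) = of_real (f i) * Y $$ (i, j)" if "i < n" "j < n" "Y \<in> M" for i j Y
      using that X by (simp_all add: diag_of_mult_index del: index_mult_mat(1))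
    have "(mat_adjoint X * (diag_of n f * (X * diag_of n g))) $$ (j, j) =
        (\<Sum>i<n. cnj (X $$ (i, j)) * (of_real (f i) * (X $$ (i, j) * of_real (g j))))" if "j < n" for j
      using that X by (subst mult_index) (auto simp: * simp del: index_mult_mat(1))
    then show ?thesis using X by (simp add: mtrace_def)
  qed
  also have "\<dots> = (\<Sum>i<n. \<Sum>j<n. of_real (f i * g j * (cmod (X $$ (i, j)))\<^sup>2))"
    by (subst sum.swap) (simp add: complex_norm_square mult_ac del: of_real_power)
  finally show ?thesis by (simp add: X_def del: of_real_power)
qed

end

subsection \<open>Parallel sums and the theorems of Lieb and Ando\<close>

definition stieltjes_kernel :: "real \<Rightarrow> real \<Rightarrow> real \<Rightarrow> real" where
  "stieltjes_kernel a x l = indicator {0<..} l * (l powr (a - 1) * (x / (x + l)))"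

text \<open>For 0 < a < 1 the value is pi / sin (pi a). It is a common factor of both sides of every
  later inequality and cancels because it is positive.\<close>

definition stieltjes_const :: "real \<Rightarrow> real" where
  "stieltjes_const a = (\<integral>l. stieltjes_kernel a 1 l \<partial>lborel)"

text \<open>Homogeneity reduces every x > 0 to x = 1. The form \<open>0 + x * l\<close> matches the
  affine substitution rules for \<open>lborel\<close>.\<close>

lemma stieltjes_kernel_scale:
  assumes "x > 0"
  shows "stieltjes_kernel a x (0 + x * l) = x powr (a - 1) * stieltjes_kernel a 1 l"
proof (cases "l > 0")
  case True
  have "x + x * l = x * (1 + l)" by (simp add: distrib_left)
  then have "x / (x + x * l) = 1 / (1 + l)"
    using assms by simp
  then show ?thesis using assms True
    by (simp add: stieltjes_kernel_def powr_mult zero_less_mult_iff)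
next
  case False
  then show ?thesis using assms by (simp add: stieltjes_kernel_def zero_less_mult_iff)
qed

lemma integrable_stieltjes_kernel:
  assumes a: "0 < a" "a < 1" and x: "x > 0"
  shows "integrable lborel (stieltjes_kernel a x)"
proof -
  have [measurable]: "stieltjes_kernel a 1 \<in> borel_measurable borel"
    unfolding stieltjes_kernel_def by measurable
  \<comment> \<open>Majorants near 0, where a > 0 gives integrability, and near infinity, where a <
    1 does.\<close>
  let ?f = "\<lambda>l. indicator {0..1} l * l powr (a - 1)"
  let ?g = "\<lambda>l. indicator {1..} l * l powr (a - 2)"
  have "(\<lambda>l. l powr (a - 1)) absolutely_integrable_on {0..1}"
    using has_integral_powr_from_0[of "a - 1" 1] a
    by (intro nonnegative_absolutely_integrable_1) (auto simp: integrable_on_def)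
  then have f: "integrable lborel ?f"
    by (simp add: set_integrable_def integrable_completion)
  have "(\<lambda>l. l powr (a - 2)) absolutely_integrable_on {1..}"
    using has_integral_powr_to_inf[of "a - 2" 1] a
    by (intro nonnegative_absolutely_integrable_1) (auto simp: integrable_on_def)
  then have g: "integrable lborel ?g"
    by (simp add: set_integrable_def integrable_completion)
  have "integrable lborel (stieltjes_kernel a 1)"
  proof (rule Bochner_Integration.integrable_bound[OF Bochner_Integration.integrable_add[OF f g]])
    have "norm (stieltjes_kernel a 1 l) \<le> norm (?f l + ?g l)" for l
    proof -
      consider "l \<le> 0" | "0 < l" "l < 1" | "1 \<le> l" by linarith
      then show ?thesis
      proof cases
        case 2
        then have "l powr (a - 1) * (1 / (1 + l)) \<le> l powr (a - 1) * 1"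
          by (intro mult_left_mono) auto
        then show ?thesis using 2 by (simp add: stieltjes_kernel_def)
      next
        case 3
        have "l powr (a - 1) * (1 / (1 + l)) \<le> l powr (a - 1) * (1 / l)"
          using 3 by (intro mult_left_mono divide_left_mono) auto
        also have "\<dots> = l powr (a - 2)"
          using 3 powr_diff[of l "a - 1" 1] by (simp add: algebra_simps)
        finally show ?thesis using 3 by (simp add: stieltjes_kernel_def indicator_def)
      qed (simp add: stieltjes_kernel_def)
    qed
    then show "AE l in lborel. norm (stieltjes_kernel a 1 l) \<le> norm (?f l + ?g l)" by simp
  qed simp
  then have "integrable lborel (\<lambda>l. stieltjes_kernel a x (0 + x * l))"
    unfolding stieltjes_kernel_scale[OF x] by (rule integrable_mult_right)
  then show ?thesis
    using x by (subst (asm) lborel_integrable_real_affine_iff) auto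
qed

lemma integral_stieltjes_kernel:
  assumes x: "x > 0"
  shows "(\<integral>l. stieltjes_kernel a x l \<partial>lborel) = stieltjes_const a * x powr a"
proof -
  have "(\<integral>l. stieltjes_kernel a x l \<partial>lborel) = x * (\<integral>l. stieltjes_kernel a x (0 + x * l) \<partial>lborel)"
    using x by (subst lborel_integral_real_affine[of x _ 0]) auto
  also have "\<dots> = x * x powr (a - 1) * stieltjes_const a"
    unfolding stieltjes_kernel_scale[OF x] stieltjes_const_def by simp
  also have "x * x powr (a - 1) = x powr a"
    using x by (simp add: powr_diff)
  finally show ?thesis by simp
qed

text \<open>On the interval from 1/2 to 1 both l^(a-1) >= 1 and 1/(1+l) >= 1/2, so this interval
  alone contributes at least 1/4.\<close>

lemma stieltjes_const_pos:
  assumes a: "0 < a" "a < 1"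
  shows "stieltjes_const a > 0"
proof -
  have "1 / 4 = (\<integral>l. indicator {1 / 2..1 :: real} l * (1 / 2 :: real) \<partial>lborel)"
    by simp
  also have "\<dots> \<le> stieltjes_const a"
    unfolding stieltjes_const_def
  proof (rule integral_mono)
    show "integrable lborel (\<lambda>l :: real. indicator {1 / 2..1 :: real} l * (1 / 2 :: real))"
      by (intro integrable_mult_left integrable_real_indicator emeasure_bounded_finite) auto
    show "integrable lborel (stieltjes_kernel a 1)" by (rule integrable_stieltjes_kernel) (use a in auto)
    fix l :: real
    show "indicator {1 / 2..1} l * (1 / 2) \<le> stieltjes_kernel a 1 l"
    proof (cases "1 / 2 \<le> l \<and> l \<le> 1")
      case True
      then have "1 * (1 / 2) \<le> l powr (a - 1) * (1 / (1 + l))"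
        using a powr_mono2'[of "a - 1" l 1] by (intro mult_mono) (auto intro!: divide_left_mono)
      then show ?thesis using True by (simp add: stieltjes_kernel_def)
    next
      case False
      then show ?thesis by (auto simp: stieltjes_kernel_def indicator_def)
    qed
  qed
  finally show ?thesis by simp
qed

text \<open>Completing the square: the two sides differ by (p + q) |y - p x / (p + q)|^2.\<close>

lemma parallel_sum_min:
  fixes x y :: complex and p q :: real
  assumes "p > 0" "q > 0"
  shows "p * q / (p + q) * (cmod x)\<^sup>2 \<le> p * (cmod (x - y))\<^sup>2 + q * (cmod y)\<^sup>2"
    and "y = of_real (p / (p + q)) * x \<Longrightarrow>
      p * (cmod (x - y))\<^sup>2 + q * (cmod y)\<^sup>2 = p * q / (p + q) * (cmod x)\<^sup>2"
proof -
  have pq: "p + q > 0" using assms by simp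
  have real: "p * (u - v)\<^sup>2 + q * v\<^sup>2 - p * q / (p + q) * u\<^sup>2 = (p + q) * (v - p / (p + q) * u)\<^sup>2" for u v
  proof -
    have *: "k * r * (u - v)\<^sup>2 + (1 - k) * r * v\<^sup>2 - k * ((1 - k) * r) * u\<^sup>2 = r * (v - k * u)\<^sup>2"
      for k r u v :: real by (simp add: power2_eq_square algebra_simps)
    define k where "k = p / (p + q)"
    have p: "p = k * (p + q)" and q: "q = (1 - k) * (p + q)"
      using pq by (simp_all add: k_def left_diff_distrib)
    have "p * q / (p + q) = k * q" by (simp add: k_def)
    then show ?thesis
      unfolding k_def[symmetric] using p q *[of k "p + q" u v] by simp
  qed
  let ?z = "y - of_real (p / (p + q)) * x"
  have "p * (cmod (x - y))\<^sup>2 + q * (cmod y)\<^sup>2 - p * q / (p + q) * (cmod x)\<^sup>2 = (p + q) * (cmod ?z)\<^sup>2"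
    using real[of "Re x" "Re y"] real[of "Im x" "Im y"] by (simp add: cmod_power2 algebra_simps)
  moreover have "(p + q) * (cmod ?z)\<^sup>2 \<ge> 0" using pq by simp
  ultimately show "p * q / (p + q) * (cmod x)\<^sup>2 \<le> p * (cmod (x - y))\<^sup>2 + q * (cmod y)\<^sup>2"
    "y = of_real (p / (p + q)) * x \<Longrightarrow>
      p * (cmod (x - y))\<^sup>2 + q * (cmod y)\<^sup>2 = p * q / (p + q) * (cmod x)\<^sup>2"
    by auto
qed

context square_mats
begin

text \<open>This is t A1 + (1 - t) A2 \<open>\<le>\<close> A in the Loewner order: by taking K of rank one, the traces recover
  the quadratic forms.\<close>
definition mix_le :: "real \<Rightarrow> complex mat \<Rightarrow> complex mat \<Rightarrow> complex mat \<Rightarrow> bool" where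
  "mix_le t A1 A2 A \<longleftrightarrow> (\<forall>K\<in>M. t * tr (mat_adjoint K * A1 * K) + (1 - t) * tr (mat_adjoint K * A2 * K)
     \<le> tr (mat_adjoint K * A * K))"

text \<open>With A and Z acting on matrices by left and right multiplication, l * g l is the value at K of the
  quadratic form of the parallel sum of A and l Z.\<close>
lemma resolvent_representation:
  assumes A: "pos_def n A" and Z: "pos_def n Z" and K: "K \<in> M"
  obtains g where
    "\<And>l L. l > 0 \<Longrightarrow> L \<in> M \<Longrightarrow>
       l * g l \<le> tr (mat_adjoint (K - L) * A * (K - L)) + l * tr (mat_adjoint (mat_adjoint L) * Z * mat_adjoint L)"
    "\<And>l. l > 0 \<Longrightarrow> \<exists>L\<in>M.
       l * g l = tr (mat_adjoint (K - L) * A * (K - L)) + l * tr (mat_adjoint (mat_adjoint L) * Z * mat_adjoint L)"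
    "\<And>a. 0 < a \<Longrightarrow> a < 1 \<Longrightarrow> has_bochner_integral lborel (\<lambda>l. indicator {0<..} l * (l powr (a - 1) * g l))
       (stieltjes_const a * tr (mat_adjoint K * mpowr A a * K * mpowr Z (1 - a)))"
    "\<And>a. 0 < a \<Longrightarrow> a < 1 \<Longrightarrow> has_bochner_integral lborel
       (\<lambda>l. indicator {0<..} l * (l powr (a - 1) * (tr (mat_adjoint K * A * K) - l * g l)))
       (stieltjes_const a * tr (mat_adjoint K * mpowr A (1 + a) * K * mpowr Z (- a)))"
proof -
  obtain U d where U: "unitary n U" and d: "\<And>i. i < n \<Longrightarrow> d i > 0" and Ad: "A = spec U d"
    using pos_def_spectral[OF A] by blast
  obtain V e where V: "unitary n V" and e: "\<And>i. i < n \<Longrightarrow> e i > 0" and Ze: "Z = spec V e"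
    using pos_def_spectral[OF Z] by blast
  note UD = unitaryD[OF U] note VD = unitaryD[OF V]
  have pA: "mpowr A r = spec U (\<lambda>i. d i powr r)" and pZ: "mpowr Z r = spec V (\<lambda>i. e i powr r)" for r
    using mpowr_spec[OF U] mpowr_spec[OF V] d e Ad Ze by blast+
  define X where "X L = mat_adjoint U * L * V" for L
  have X: "X L \<in> M" if "L \<in> M" for L using that UD VD by (simp add: X_def)
  have trX: "tr (mat_adjoint L * spec U f * L * spec V h)
      = (\<Sum>i<n. \<Sum>j<n. f i * h j * (cmod (X L $$ (i, j)))\<^sup>2)" if "L \<in> M" for L f h
    unfolding X_def by (rule tr_spec[OF U V that])
  \<comment> \<open>The coefficient is e_j times x / (x + l) at x = d_i / e_j, so that the Stieltjes
    integral yields e_j (d_i / e_j)^a = d_i^a e_j^(1-a).\<close>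
  define g where "g l = (\<Sum>i<n. \<Sum>j<n. d i * e j / (d i + l * e j) * (cmod (X K $$ (i, j)))\<^sup>2)" for l
  have lg: "l * g l = (\<Sum>i<n. \<Sum>j<n. d i * (l * e j) / (d i + l * e j) * (cmod (X K $$ (i, j)))\<^sup>2)" for l
    by (simp add: g_def sum_distrib_left mult_ac)
  \<comment> \<open>The double adjoint puts the second trace into the form K* Z K with K = L*, the
    form on which \<open>mix_le\<close> acts.\<close>
  have quad: "tr (mat_adjoint (K - L) * A * (K - L)) + l * tr (mat_adjoint (mat_adjoint L) * Z * mat_adjoint L)
      = (\<Sum>i<n. \<Sum>j<n. d i * (cmod (X K $$ (i, j) - X L $$ (i, j)))\<^sup>2 + (l * e j) * (cmod (X L $$ (i, j)))\<^sup>2)"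
    if L: "L \<in> M" for l L
  proof -
    have "tr (mat_adjoint (K - L) * A * (K - L)) = tr (mat_adjoint (K - L) * spec U d * (K - L) * spec V (\<lambda>_. 1))"
      using K L UD by (simp add: Ad spec_one[OF V])
    also have "\<dots> = (\<Sum>i<n. \<Sum>j<n. d i * (cmod (X (K - L) $$ (i, j)))\<^sup>2)"
      using K L by (subst trX) auto
    also have "X (K - L) = X K - X L"
      using K L UD VD by (simp add: X_def mult_minus_distrib_mat[of _ n n _ n] minus_mult_distrib_mat[of _ n n _ _ n])
    finally have 1: "tr (mat_adjoint (K - L) * A * (K - L)) =
       (\<Sum>i<n. \<Sum>j<n. d i * (cmod (X K $$ (i, j) - X L $$ (i, j)))\<^sup>2)"
      using X[OF K] X[OF L] by simp
    have "mtrace (mat_adjoint (mat_adjoint L) * Z * mat_adjoint L) = mtrace (mat_adjoint L * (L * Z))"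
      using L pos_def_closed[OF Z] by (subst mtrace_comm) auto
    then have "tr (mat_adjoint (mat_adjoint L) * Z * mat_adjoint L) = tr (mat_adjoint L * spec U (\<lambda>_. 1) * L * spec V e)"
      using L pos_def_closed[OF Z] by (simp add: Ze[symmetric] spec_one[OF U] mult_assoc)
    also have "\<dots> = (\<Sum>i<n. \<Sum>j<n. e j * (cmod (X L $$ (i, j)))\<^sup>2)"
      using L by (subst trX) auto
    finally show ?thesis using 1
      by (simp add: sum.distrib sum_distrib_left mult_ac)
  qed
  show ?thesis
  proof (rule that)
    fix l :: real and L assume l: "l > 0" and L: "L \<in> M"
    show "l * g l \<le> tr (mat_adjoint (K - L) * A * (K - L)) + l * tr (mat_adjoint (mat_adjoint L) * Z * mat_adjoint L)"
      unfolding lg quad[OF L] using d e l by (intro sum_mono parallel_sum_min) auto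
  next
    fix l :: real assume l: "l > 0"
    \<comment> \<open>The minimiser of \<open>parallel_sum_min\<close> in each entry, in eigenbasis
      coordinates; \<open>L\<close> is its preimage under \<open>X\<close>.\<close>
    define Y where "Y = mat n n (\<lambda>(i, j). of_real (d i / (d i + l * e j)) * X K $$ (i, j))"
    define L where "L = U * Y * mat_adjoint V"
    have Y: "Y \<in> M" by (simp add: Y_def)
    then have L: "L \<in> M" using UD VD by (simp add: L_def)
    have XL: "X L = Y" using Y UD VD by (simp add: X_def L_def mult_assoc unitary_cancel[OF U] unitary_cancel[OF V])
    have "l * g l = tr (mat_adjoint (K - L) * A * (K - L)) + l * tr (mat_adjoint (mat_adjoint L) * Z * mat_adjoint L)"
      unfolding lg quad[OF L] XL using d e l
      by (intro sum.cong refl parallel_sum_min(2)[symmetric]) (auto simp: Y_def)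
    then show "\<exists>L\<in>M. l * g l = tr (mat_adjoint (K - L) * A * (K - L)) + l * tr (mat_adjoint (mat_adjoint L) * Z * mat_adjoint L)"
      using L by blast
  next
    fix a :: real assume a: "0 < a" "a < 1"
    have kernel: "has_bochner_integral lborel (stieltjes_kernel a (d i / e j)) (stieltjes_const a * (d i / e j) powr a)"
      if "i < n" "j < n" for i j
      using integrable_stieltjes_kernel[OF a] integral_stieltjes_kernel that d[of i] e[of j]
      by (simp add: has_bochner_integral_iff)
    have *: "has_bochner_integral lborel
        (\<lambda>l. \<Sum>i<n. \<Sum>j<n. c i j * stieltjes_kernel a (d i / e j) l)
        (\<Sum>i<n. \<Sum>j<n. c i j * (stieltjes_const a * (d i / e j) powr a))" for c
      by (intro has_bochner_integral_sum has_bochner_integral_mult_right kernel) auto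
    have kl: "stieltjes_kernel a (d i / e j) l = indicator {0<..} l * (l powr (a - 1) * (d i / (d i + l * e j)))"
      if "i < n" "j < n" for i j l
      using e[OF that(2)] by (simp add: stieltjes_kernel_def field_simps)
    have g: "indicator {0<..} l * (l powr (a - 1) * g l) =
        (\<Sum>i<n. \<Sum>j<n. (e j * (cmod (X K $$ (i, j)))\<^sup>2) * stieltjes_kernel a (d i / e j) l)" for l
      by (simp add: g_def kl sum_distrib_left mult_ac)
    have p: "e j * (d i / e j) powr a = d i powr a * e j powr (1 - a)" if "i < n" "j < n" for i j
      using d[OF that(1)] e[OF that(2)] by (simp add: powr_divide powr_diff)
    have "stieltjes_const a * tr (mat_adjoint K * mpowr A a * K * mpowr Z (1 - a))
        = (\<Sum>i<n. \<Sum>j<n. (e j * (cmod (X K $$ (i, j)))\<^sup>2) * (stieltjes_const a * (d i / e j) powr a))"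
      unfolding pA pZ trX[OF K] sum_distrib_left
      by (intro sum.cong refl) (simp flip: p)
    then show "has_bochner_integral lborel (\<lambda>l. indicator {0<..} l * (l powr (a - 1) * g l))
       (stieltjes_const a * tr (mat_adjoint K * mpowr A a * K * mpowr Z (1 - a)))"
      using *[of "\<lambda>i j. e j * (cmod (X K $$ (i, j)))\<^sup>2"] by (simp only: g)
    have trA: "tr (mat_adjoint K * A * K) = (\<Sum>i<n. \<Sum>j<n. d i * (cmod (X K $$ (i, j)))\<^sup>2)"
      using trX[OF K, of d "\<lambda>_. 1"] K UD by (simp add: spec_one[OF V] Ad)
    have h: "indicator {0<..} l * (l powr (a - 1) * (tr (mat_adjoint K * A * K) - l * g l)) =
        (\<Sum>i<n. \<Sum>j<n. (d i * (cmod (X K $$ (i, j)))\<^sup>2) * stieltjes_kernel a (d i / e j) l)" for l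
    proof (cases "l > 0")
      case True
      \<comment> \<open>Subtracting the parallel sum from d leaves d * d / (d + l e), again a
        Stieltjes kernel, now with prefactor d. This raises the exponent of A from a to 1 + a and
        lowers that of Z from 1 - a to -a.\<close>
      have "d i * x - d i * (l * e j) / (d i + l * e j) * x = d i * x * (d i / (d i + l * e j))"
        if "i < n" "j < n" for i j x
      proof -
        have "d i + l * e j > 0" using d[OF that(1)] e[OF that(2)] True by (intro add_pos_pos) auto
        then show ?thesis by (simp add: field_simps)
      qed
      then have "tr (mat_adjoint K * A * K) - l * g l
        = (\<Sum>i<n. \<Sum>j<n. d i * (cmod (X K $$ (i, j)))\<^sup>2 * (d i / (d i + l * e j)))"
        unfolding lg trA by (simp flip: sum_subtractf)
      then show ?thesis by (simp add: kl sum_distrib_left mult_ac)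
    qed (simp add: kl)
    have q: "d i * (d i / e j) powr a = d i powr (1 + a) * e j powr (- a)" if "i < n" "j < n" for i j
      using d[OF that(1)] e[OF that(2)] by (simp add: powr_divide powr_add powr_minus_divide)
    have "stieltjes_const a * tr (mat_adjoint K * mpowr A (1 + a) * K * mpowr Z (- a))
        = (\<Sum>i<n. \<Sum>j<n. (d i * (cmod (X K $$ (i, j)))\<^sup>2) * (stieltjes_const a * (d i / e j) powr a))"
      unfolding pA pZ trX[OF K] sum_distrib_left
      by (intro sum.cong refl) (simp flip: q)
    then show "has_bochner_integral lborel
       (\<lambda>l. indicator {0<..} l * (l powr (a - 1) * (tr (mat_adjoint K * A * K) - l * g l)))
       (stieltjes_const a * tr (mat_adjoint K * mpowr A (1 + a) * K * mpowr Z (- a)))"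
      using *[of "\<lambda>i j. d i * (cmod (X K $$ (i, j)))\<^sup>2"] by (simp only: h)
  qed
qed

end

lemma has_bochner_integral_mono:
  fixes f g :: "'a \<Rightarrow> real"
  assumes "has_bochner_integral N f x" "has_bochner_integral N g y" "\<And>l. f l \<le> g l"
  shows "x \<le> y"
  using assms integral_mono[of N f g] by (auto simp: has_bochner_integral_iff)

context square_mats
begin

section \<open>Convex combinations, the Loewner order and the two trace theorems\<close>

abbreviation mix :: "real \<Rightarrow> complex mat \<Rightarrow> complex mat \<Rightarrow> complex mat" where
  "mix t A B \<equiv> complex_of_real t \<cdot>\<^sub>m A + complex_of_real (1 - t) \<cdot>\<^sub>m B"

lemma tr_mix: "A \<in> M \<Longrightarrow> B \<in> M \<Longrightarrow> tr (mix t A B) = t * tr A + (1 - t) * tr B"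
  by (simp add: mtrace_add mtrace_smult)

lemma tr_congruence_mix:
  assumes "A \<in> M" "B \<in> M" "K \<in> M"
  shows "tr (mat_adjoint K * mix t A B * K) =
    t * tr (mat_adjoint K * A * K) + (1 - t) * tr (mat_adjoint K * B * K)"
proof -
  have "mat_adjoint K * mix t A B * K = mix t (mat_adjoint K * A * K) (mat_adjoint K * B * K)"
    using assms by (simp add: mult_add_distrib_mat[of _ n n _ n] add_mult_distrib_mat[of _ n n _ _ n]
        mult_smult_distrib[of _ n n _ n] mult_smult_assoc_mat[of _ n n _ n])
  then show ?thesis using assms by (simp only: tr_mix mult_closed adjoint_closed)
qed

lemma mix_le_mix: "A \<in> M \<Longrightarrow> B \<in> M \<Longrightarrow> mix_le t A B (mix t A B)"
  by (simp add: mix_le_def tr_congruence_mix del: of_real_diff)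

lemma mix_le_refl: "mix_le t A A A"
  by (simp add: mix_le_def algebra_simps)

lemma mix_leD:
  "mix_le t A1 A2 A \<Longrightarrow> K \<in> M \<Longrightarrow>
    t * tr (mat_adjoint K * A1 * K) + (1 - t) * tr (mat_adjoint K * A2 * K) \<le> tr (mat_adjoint K * A * K)"
  by (simp add: mix_le_def)

lemma mix_le_tr:
  assumes "mix_le t A1 A2 A" "A1 \<in> M" "A2 \<in> M" "A \<in> M"
  shows "t * tr A1 + (1 - t) * tr A2 \<le> tr A"
  using mix_leD[OF assms(1), of "1\<^sub>m n"] assms by simp

lemma mix_le_congruence:
  assumes "mix_le t A1 A2 A" and "A1 \<in> M" "A2 \<in> M" "A \<in> M" "R \<in> M"
  shows "mix_le t (mat_adjoint R * A1 * R) (mat_adjoint R * A2 * R) (mat_adjoint R * A * R)"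
  unfolding mix_le_def
proof
  fix K assume K: "K \<in> M"
  show "t * tr (mat_adjoint K * (mat_adjoint R * A1 * R) * K) + (1 - t) * tr (mat_adjoint K * (mat_adjoint R * A2 * R) * K)
      \<le> tr (mat_adjoint K * (mat_adjoint R * A * R) * K)"
    using mix_leD[OF assms(1), of "R * K"] assms(2-) K by (simp add: adjoint_mult mult_assoc)
qed

text \<open>A minimum of functions linear in (A, Z) is concave, and integration against the positive
  weight l^(a-1) preserves this. For Ando's part the parallel sum is subtracted from the linear term
  tr (K* A K). That term has a plus sign, so a Loewner bound on A would point the wrong way;
  therefore A is an exact mixture there, while Z may still be larger than the mixture.\<close>

lemma
  assumes A1: "pos_def n A1" and A2: "pos_def n A2" and A: "pos_def n A"
    and Z1: "pos_def n Z1" and Z2: "pos_def n Z2" and Z: "pos_def n Z"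
    and t: "0 \<le> t" "t \<le> 1" and mA: "mix_le t A1 A2 A" and mZ: "mix_le t Z1 Z2 Z"
    and K: "K \<in> M" and a: "0 < a" "a < 1"
  shows Lieb_concavity_open:
      "t * tr (mat_adjoint K * mpowr A1 a * K * mpowr Z1 (1 - a)) +
      (1 - t) * tr (mat_adjoint K * mpowr A2 a * K * mpowr Z2 (1 - a))
      \<le> tr (mat_adjoint K * mpowr A a * K * mpowr Z (1 - a))"
    and Ando_convexity_open:
      "A = mix t A1 A2 \<Longrightarrow> tr (mat_adjoint K * mpowr A (1 + a) * K * mpowr Z (- a))
      \<le> t * tr (mat_adjoint K * mpowr A1 (1 + a) * K * mpowr Z1 (- a)) +
      (1 - t) * tr (mat_adjoint K * mpowr A2 (1 + a) * K * mpowr Z2 (- a))"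
proof -
  note closed = pos_def_closed[OF A1] pos_def_closed[OF A2] pos_def_closed[OF A]
    pos_def_closed[OF Z1] pos_def_closed[OF Z2] pos_def_closed[OF Z]
  note c = stieltjes_const_pos[OF a]
  obtain g1 where g1: "\<And>l L. l > 0 \<Longrightarrow> L \<in> M \<Longrightarrow>
       l * g1 l \<le> tr (mat_adjoint (K - L) * A1 * (K - L)) + l * tr (mat_adjoint (mat_adjoint L) * Z1 * mat_adjoint L)"
    "has_bochner_integral lborel (\<lambda>l. indicator {0<..} l * (l powr (a - 1) * g1 l))
       (stieltjes_const a * tr (mat_adjoint K * mpowr A1 a * K * mpowr Z1 (1 - a)))"
    "has_bochner_integral lborel
       (\<lambda>l. indicator {0<..} l * (l powr (a - 1) * (tr (mat_adjoint K * A1 * K) - l * g1 l)))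
       (stieltjes_const a * tr (mat_adjoint K * mpowr A1 (1 + a) * K * mpowr Z1 (- a)))"
    by (rule resolvent_representation[OF A1 Z1 K]) (use a in blast)
  obtain g2 where g2: "\<And>l L. l > 0 \<Longrightarrow> L \<in> M \<Longrightarrow>
       l * g2 l \<le> tr (mat_adjoint (K - L) * A2 * (K - L)) + l * tr (mat_adjoint (mat_adjoint L) * Z2 * mat_adjoint L)"
    "has_bochner_integral lborel (\<lambda>l. indicator {0<..} l * (l powr (a - 1) * g2 l))
       (stieltjes_const a * tr (mat_adjoint K * mpowr A2 a * K * mpowr Z2 (1 - a)))"
    "has_bochner_integral lborel
       (\<lambda>l. indicator {0<..} l * (l powr (a - 1) * (tr (mat_adjoint K * A2 * K) - l * g2 l)))
       (stieltjes_const a * tr (mat_adjoint K * mpowr A2 (1 + a) * K * mpowr Z2 (- a)))"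
    by (rule resolvent_representation[OF A2 Z2 K]) (use a in blast)
  obtain g where g: "\<And>l. l > 0 \<Longrightarrow> \<exists>L\<in>M.
       l * g l = tr (mat_adjoint (K - L) * A * (K - L)) + l * tr (mat_adjoint (mat_adjoint L) * Z * mat_adjoint L)"
    "has_bochner_integral lborel (\<lambda>l. indicator {0<..} l * (l powr (a - 1) * g l))
       (stieltjes_const a * tr (mat_adjoint K * mpowr A a * K * mpowr Z (1 - a)))"
    "has_bochner_integral lborel
       (\<lambda>l. indicator {0<..} l * (l powr (a - 1) * (tr (mat_adjoint K * A * K) - l * g l)))
       (stieltjes_const a * tr (mat_adjoint K * mpowr A (1 + a) * K * mpowr Z (- a)))"
    by (rule resolvent_representation[OF A Z K]) (use a in blast)
  have lg: "t * (l * g1 l) + (1 - t) * (l * g2 l) \<le> l * g l" if l: "l > 0" for l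
  proof -
    \<comment> \<open>The minimiser for the mixed pair serves as competitor at both end
      points.\<close>
    obtain L where L: "L \<in> M"
      and eq: "l * g l = tr (mat_adjoint (K - L) * A * (K - L)) + l * tr (mat_adjoint (mat_adjoint L) * Z * mat_adjoint L)"
      using g(1)[OF l] by blast
    let ?a = "\<lambda>A. tr (mat_adjoint (K - L) * A * (K - L))"
    let ?z = "\<lambda>Z. tr (mat_adjoint (mat_adjoint L) * Z * mat_adjoint L)"
    have KL: "K - L \<in> M" using K L by (simp add: minus_carrier_mat)
    have "t * (l * g1 l) + (1 - t) * (l * g2 l) \<le> t * (?a A1 + l * ?z Z1) + (1 - t) * (?a A2 + l * ?z Z2)"
      using g1(1)[OF l L] g2(1)[OF l L] t by (intro add_mono mult_left_mono) auto
    also have "\<dots> = (t * ?a A1 + (1 - t) * ?a A2) + l * (t * ?z Z1 + (1 - t) * ?z Z2)"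
      by (simp only: distrib_left mult_ac add_ac)
    also have "\<dots> \<le> ?a A + l * ?z Z"
      using mix_leD[OF mA KL] mix_leD[OF mZ adjoint_closed[OF L]] l by (intro add_mono mult_left_mono) auto
    finally show ?thesis using eq by simp
  qed
  let ?k = "\<lambda>g l. indicator {0<..} l * (l powr (a - 1) * g l)"
  have I: "has_bochner_integral lborel (\<lambda>l. t * ?k g1 l + (1 - t) * ?k g2 l)
    (t * (stieltjes_const a * tr (mat_adjoint K * mpowr A1 a * K * mpowr Z1 (1 - a)))
      + (1 - t) * (stieltjes_const a * tr (mat_adjoint K * mpowr A2 a * K * mpowr Z2 (1 - a))))"
    by (intro has_bochner_integral_add has_bochner_integral_mult_right g1(2) g2(2))
  have "t * ?k g1 l + (1 - t) * ?k g2 l \<le> ?k g l" for l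
  proof (cases "l > 0")
    case True
    have "l * (t * g1 l + (1 - t) * g2 l) \<le> l * g l" using lg[OF True] by (simp add: algebra_simps)
    then have "t * g1 l + (1 - t) * g2 l \<le> g l" using True by simp
    then have "l powr (a - 1) * (t * g1 l + (1 - t) * g2 l) \<le> l powr (a - 1) * g l"
      by (intro mult_left_mono) auto
    then show ?thesis using True by (simp add: algebra_simps)
  qed simp
  from has_bochner_integral_mono[OF I g(2) this]
  have "stieltjes_const a * (t * tr (mat_adjoint K * mpowr A1 a * K * mpowr Z1 (1 - a)) +
      (1 - t) * tr (mat_adjoint K * mpowr A2 a * K * mpowr Z2 (1 - a)))
      \<le> stieltjes_const a * tr (mat_adjoint K * mpowr A a * K * mpowr Z (1 - a))"
    by (simp only: distrib_left mult.left_commute)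
  then show "t * tr (mat_adjoint K * mpowr A1 a * K * mpowr Z1 (1 - a)) +
      (1 - t) * tr (mat_adjoint K * mpowr A2 a * K * mpowr Z2 (1 - a))
      \<le> tr (mat_adjoint K * mpowr A a * K * mpowr Z (1 - a))"
    using c by simp
  assume Amix: "A = mix t A1 A2"
  let ?h = "\<lambda>A g l. indicator {0<..} l * (l powr (a - 1) * (tr (mat_adjoint K * A * K) - l * g l))"
  have I: "has_bochner_integral lborel (\<lambda>l. t * ?h A1 g1 l + (1 - t) * ?h A2 g2 l)
    (t * (stieltjes_const a * tr (mat_adjoint K * mpowr A1 (1 + a) * K * mpowr Z1 (- a)))
      + (1 - t) * (stieltjes_const a * tr (mat_adjoint K * mpowr A2 (1 + a) * K * mpowr Z2 (- a))))"
    by (intro has_bochner_integral_add has_bochner_integral_mult_right g1(3) g2(3))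
  have "?h A g l \<le> t * ?h A1 g1 l + (1 - t) * ?h A2 g2 l" for l
  proof (cases "l > 0")
    case True
    let ?T = "\<lambda>A. tr (mat_adjoint K * A * K)"
    have "?T A = t * ?T A1 + (1 - t) * ?T A2"
      unfolding Amix using closed K by (simp add: tr_congruence_mix del: of_real_diff)
    then have "?T A - l * g l \<le> t * (?T A1 - l * g1 l) + (1 - t) * (?T A2 - l * g2 l)"
      using lg[OF True] by (simp add: right_diff_distrib)
    then have "l powr (a - 1) * (?T A - l * g l)
      \<le> l powr (a - 1) * (t * (?T A1 - l * g1 l) + (1 - t) * (?T A2 - l * g2 l))"
      by (intro mult_left_mono) auto
    then show ?thesis using True by (simp add: distrib_left mult.left_commute)
  qed simp
  from has_bochner_integral_mono[OF g(3) I this]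
  have "stieltjes_const a * tr (mat_adjoint K * mpowr A (1 + a) * K * mpowr Z (- a))
    \<le> stieltjes_const a * (t * tr (mat_adjoint K * mpowr A1 (1 + a) * K * mpowr Z1 (- a)) +
      (1 - t) * tr (mat_adjoint K * mpowr A2 (1 + a) * K * mpowr Z2 (- a)))"
    by (simp only: distrib_left mult.left_commute)
  then show "tr (mat_adjoint K * mpowr A (1 + a) * K * mpowr Z (- a))
      \<le> t * tr (mat_adjoint K * mpowr A1 (1 + a) * K * mpowr Z1 (- a)) +
      (1 - t) * tr (mat_adjoint K * mpowr A2 (1 + a) * K * mpowr Z2 (- a))"
    using c by simp
qed

text \<open>The Stieltjes integral only covers open ranges of exponents; continuity in the exponent
  supplies the end points, among them a = 1 and p = 1, 2.\<close>

lemma continuous_on_tr_mpowr: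
  assumes A: "pos_def n A" and Z: "pos_def n Z" and K: "K \<in> M"
  shows "continuous_on S (\<lambda>a. tr (mat_adjoint K * mpowr A a * K * mpowr Z (1 - a)))"
proof -
  obtain U d where U: "unitary n U" and d: "\<And>i. i < n \<Longrightarrow> d i > 0" and Ad: "A = spec U d"
    using pos_def_spectral[OF A] by blast
  obtain V e where V: "unitary n V" and e: "\<And>i. i < n \<Longrightarrow> e i > 0" and Ze: "Z = spec V e"
    using pos_def_spectral[OF Z] by blast
  have "mpowr A r = spec U (\<lambda>i. d i powr r)" "mpowr Z r = spec V (\<lambda>i. e i powr r)" for r
    using mpowr_spec[OF U] mpowr_spec[OF V] d e Ad Ze by blast+
  then have eq: "(\<lambda>a. tr (mat_adjoint K * mpowr A a * K * mpowr Z (1 - a))) =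
      (\<lambda>a. \<Sum>i<n. \<Sum>j<n. d i powr a * e j powr (1 - a) * (cmod ((mat_adjoint U * K * V) $$ (i, j)))\<^sup>2)"
    by (simp only: tr_spec[OF U V K])
  show ?thesis unfolding eq using d e
    by (intro continuous_intros) (auto simp: less_imp_neq[symmetric] dest: less_imp_neq)
qed

context
  fixes A1 A2 A Z1 Z2 Z K :: "complex mat" and t :: real
  assumes pos: "pos_def n A1" "pos_def n A2" "pos_def n A" "pos_def n Z1" "pos_def n Z2" "pos_def n Z"
    and t: "0 \<le> t" "t \<le> 1" and mZ: "mix_le t Z1 Z2 Z" and K: "K \<in> M"
begin

lemma Lieb_concavity:
  assumes mA: "mix_le t A1 A2 A" and a: "0 \<le> a" "a \<le> 1"
  shows "t * tr (mat_adjoint K * mpowr A1 a * K * mpowr Z1 (1 - a)) +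
      (1 - t) * tr (mat_adjoint K * mpowr A2 a * K * mpowr Z2 (1 - a))
      \<le> tr (mat_adjoint K * mpowr A a * K * mpowr Z (1 - a))"
proof -
  let ?F = "\<lambda>A Z a. tr (mat_adjoint K * mpowr A a * K * mpowr Z (1 - a))"
  have "t * ?F A1 Z1 a + (1 - t) * ?F A2 Z2 a - ?F A Z a \<le> 0"
  proof (rule continuous_le_on_closure[where S = "{0<..<1}"
        and f = "\<lambda>a. t * ?F A1 Z1 a + (1 - t) * ?F A2 Z2 a - ?F A Z a"])
    show "continuous_on (closure {0<..<1}) (\<lambda>a. t * ?F A1 Z1 a + (1 - t) * ?F A2 Z2 a - ?F A Z a)"
      using pos K by (intro continuous_intros continuous_on_tr_mpowr)
    show "a \<in> closure {0<..<1}" using a by simp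
    show "t * ?F A1 Z1 x + (1 - t) * ?F A2 Z2 x - ?F A Z x \<le> 0" if "x \<in> {0<..<1}" for x
      using Lieb_concavity_open[OF pos t mA mZ K, of x] that by simp
  qed
  then show ?thesis by simp
qed

lemma Ando_convexity:
  assumes A: "A = mix t A1 A2" and p: "1 \<le> p" "p \<le> 2"
  shows "tr (mat_adjoint K * mpowr A p * K * mpowr Z (1 - p))
      \<le> t * tr (mat_adjoint K * mpowr A1 p * K * mpowr Z1 (1 - p)) +
      (1 - t) * tr (mat_adjoint K * mpowr A2 p * K * mpowr Z2 (1 - p))"
proof -
  let ?F = "\<lambda>A Z a. tr (mat_adjoint K * mpowr A a * K * mpowr Z (1 - a))"
  have mA: "mix_le t A1 A2 A" unfolding A using pos by (intro mix_le_mix) auto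
  have "?F A Z p - (t * ?F A1 Z1 p + (1 - t) * ?F A2 Z2 p) \<le> 0"
  proof (rule continuous_le_on_closure[where S = "{1<..<2}"
        and f = "\<lambda>a. ?F A Z a - (t * ?F A1 Z1 a + (1 - t) * ?F A2 Z2 a)"])
    show "continuous_on (closure {1<..<2}) (\<lambda>a. ?F A Z a - (t * ?F A1 Z1 a + (1 - t) * ?F A2 Z2 a))"
      using pos K by (intro continuous_intros continuous_on_tr_mpowr)
    show "p \<in> closure {1<..<2}" using p by simp
    \<comment> \<open>With a = x - 1 the exponents 1 + a and -a become x and 1 - x.\<close>
    show "?F A Z x - (t * ?F A1 Z1 x + (1 - t) * ?F A2 Z2 x) \<le> 0" if "x \<in> {1<..<2}" for x
      using Ando_convexity_open[OF pos t mA mZ K, of "x - 1"] that A by simp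
  qed
  then show ?thesis by simp
qed

end


section \<open>Young's inequality for traces and polar decomposition\<close>

text \<open>By \<open>tr_spec\<close> this is the scalar inequality x v^(1-1/s) <= x^s / s + (1 -
  1/s) v, summed with the squared overlaps of the two eigenbases as weights. Equality holds at V =
  X^s, hence the variational formula for tr X^s.\<close>

lemma tr_Young:
  assumes X: "pos_def n X" and V: "pos_def n V" and s: "s \<ge> 1"
  shows "s * tr (X * mpowr V (1 - 1 / s)) - (s - 1) * tr V \<le> tr (mpowr X s)"
proof -
  obtain U d where U: "unitary n U" and d: "\<And>i. i < n \<Longrightarrow> d i > 0" and Xd: "X = spec U d"
    using pos_def_spectral[OF X] by blast
  obtain W e where W: "unitary n W" and e: "\<And>i. i < n \<Longrightarrow> e i > 0" and Ve: "V = spec W e"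
    using pos_def_spectral[OF V] by blast
  have pX: "mpowr X r = spec U (\<lambda>i. d i powr r)" and pV: "mpowr V r = spec W (\<lambda>i. e i powr r)" for r
    using mpowr_spec[OF U] mpowr_spec[OF W] d e Xd Ve by blast+
  note UD = unitaryD(1)[OF U] and WD = unitaryD(1)[OF W]
  let ?c = "\<lambda>i j. (cmod ((mat_adjoint U * 1\<^sub>m n * W) $$ (i, j)))\<^sup>2"
  have tr2: "tr (spec U f * spec W h) = (\<Sum>i<n. \<Sum>j<n. f i * h j * ?c i j)" for f h
    using tr_spec[OF U W, of "1\<^sub>m n" f h] UD WD by simp
  have "tr (X * mpowr V (1 - 1 / s)) = (\<Sum>i<n. \<Sum>j<n. d i * e j powr (1 - 1 / s) * ?c i j)"
    unfolding pV Xd tr2 ..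
  also have "\<dots> \<le> (\<Sum>i<n. \<Sum>j<n. (1 / s * d i powr s + (1 - 1 / s) * e j) * ?c i j)"
  proof (intro sum_mono mult_right_mono)
    fix i j assume "i \<in> {..<n}" "j \<in> {..<n}"
    then have "d i > 0" "e j > 0" using d e by auto
    then show "d i * e j powr (1 - 1 / s) \<le> 1 / s * d i powr s + (1 - 1 / s) * e j"
      using Youngs_inequality_0[of "1 / s" "1 - 1 / s" "d i powr s" "e j"] s
      by (simp add: powr_powr)
  qed simp
  \<comment> \<open>An eigenvalue sequence that is constantly 1 gives the identity matrix, which
    separates the two variables.\<close>
  also have "\<dots> = 1 / s * tr (spec U (\<lambda>i. d i powr s) * spec W (\<lambda>_. 1)) + (1 - 1 / s) * tr (spec U (\<lambda>_. 1) * spec W e)"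
    unfolding tr2 by (simp add: sum.distrib sum_distrib_left distrib_right mult_ac)
  also have "\<dots> = 1 / s * tr (mpowr X s) + (1 - 1 / s) * tr V"
    using UD WD by (simp add: spec_one[OF U] spec_one[OF W] pX Ve)
  finally have "s * tr (X * mpowr V (1 - 1 / s)) \<le> s * (1 / s * tr (mpowr X s) + (1 - 1 / s) * tr V)"
    using s by (intro mult_left_mono) auto
  also have "\<dots> = tr (mpowr X s) + (s - 1) * tr V"
    using s by (simp add: distrib_left right_diff_distrib left_diff_distrib)
  finally show ?thesis by simp
qed

text \<open>With P = C* C the polar decomposition is C = U P^(1/2), so C C* = U P U*. Powers of C C*
  are then U P^r U*, and the unitary factor drops out of both claims.\<close>

lemma mpowr_polar:
  assumes C: "C \<in> M" "D \<in> M" "D * C = 1\<^sub>m n"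
  shows "mtrace (mpowr (C * mat_adjoint C) r) = mtrace (mpowr (mat_adjoint C * C) r)"
    and "mat_adjoint C * mpowr (C * mat_adjoint C) r * C = mpowr (mat_adjoint C * C) (1 + r)"
proof -
  define P where "P = mat_adjoint C * C"
  have P: "pos_def n P"
    using pos_def_congruence[OF pos_def_one C] C by (simp add: P_def)
  note pow = mpowr_mult[OF P] mpowr_one[OF P] mpowr_zero[OF P]
  have pow': "mpowr P r * (mpowr P s * X) = mpowr P (r + s) * X" if "X \<in> M" for r s X
    using mult_assoc[of "mpowr P r" "mpowr P s" X] that P by (simp add: pow)
  define U where "U = C * mpowr P (- (1 / 2))"
  have U: "U \<in> M" using C P by (simp add: U_def)
  have "mat_adjoint U * U = mpowr P (- (1 / 2)) * (mat_adjoint C * C) * mpowr P (- (1 / 2))"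
    using C P by (simp add: U_def adjoint_mult mult_assoc)
  also have "\<dots> = mpowr P (- (1 / 2)) * mpowr P 1 * mpowr P (- (1 / 2))"
    by (simp add: P_def[symmetric] pow)
  also have "\<dots> = 1\<^sub>m n" unfolding pow(1) by (simp add: pow(3))
  finally have un: "unitary n U" using U by (simp add: unitary_def)
  note UD = unitaryD[OF un] note cancel = unitary_cancel[OF un]
  have CU: "C = U * mpowr P (1 / 2)"
    using C P by (simp add: U_def mult_assoc pow)
  have "mat_adjoint C = mpowr P (1 / 2) * mat_adjoint U"
    unfolding CU using U P by (simp add: adjoint_mult)
  then have "C * mat_adjoint C = U * (mpowr P (1 / 2) * mpowr P (1 / 2)) * mat_adjoint U"
    using U P by (subst CU) (simp add: mult_assoc)
  then have CC: "C * mat_adjoint C = U * P * mat_adjoint U" by (simp add: pow)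
  have pCC: "mpowr (C * mat_adjoint C) r = U * mpowr P r * mat_adjoint U"
    unfolding CC by (rule mpowr_unitary_conjugate[OF un P])
  have "mtrace (U * mpowr P r * mat_adjoint U) = mtrace (mat_adjoint U * (U * mpowr P r))"
    using U P by (subst mtrace_comm) auto
  then show "mtrace (mpowr (C * mat_adjoint C) r) = mtrace (mpowr (mat_adjoint C * C) r)"
    unfolding pCC using P by (simp add: cancel P_def)
  have "mat_adjoint C * mpowr (C * mat_adjoint C) r * C = mpowr P (1 / 2) * mpowr P r * mpowr P (1 / 2)"
    unfolding pCC using U P \<open>mat_adjoint C = _\<close>
    by (subst (2) CU) (simp add: mult_assoc cancel)
  also have "\<dots> = mpowr P (1 + r)" unfolding pow(1) by (simp add: algebra_simps)
  finally show "mat_adjoint C * mpowr (C * mat_adjoint C) r * C = mpowr (mat_adjoint C * C) (1 + r)"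
    by (simp add: P_def)
qed


subsection \<open>Variational formulas\<close>

abbreviation inner_mat :: "real \<Rightarrow> real \<Rightarrow> complex mat \<Rightarrow> complex mat \<Rightarrow> complex mat" where
  "inner_mat p a A B \<equiv> mpowr A (- (a / 2)) * mpowr B p * mpowr A (- (a / 2))"

lemma pos_def_sandwich:
  assumes "pos_def n X" "pos_def n Y"
  shows "pos_def n (mpowr X r * Y * mpowr X r)"
  using pos_def_congruence[of Y "mpowr X r" "mpowr X (- r)"] assms
  by (simp add: mpowr_mult mpowr_zero)

lemma mpowr_cancel:
  assumes A: "pos_def n A" and Y: "Y \<in> M"
  shows "mpowr A r * (mpowr A (- r) * Y) = Y"
proof -
  have "mpowr A r * (mpowr A (- r) * Y) = mpowr A r * mpowr A (- r) * Y"
    using A Y by (simp add: mult_assoc)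
  then show ?thesis using Y by (simp add: mpowr_mult[OF A] mpowr_zero[OF A])
qed

context
  fixes A B R C :: "complex mat" and p a s :: real
  assumes A: "pos_def n A" and B: "pos_def n B" and R: "pos_def n R" and s: "s \<ge> 1"
    and C_def: "C = R * mpowr A (a / 2)"
begin

lemma C_closed: "C \<in> M" using A R by (simp add: C_def)

lemma C_left_inverse: "\<exists>D\<in>M. D * C = 1\<^sub>m n"
proof
  show "mpowr A (- (a / 2)) * mpowr R (- 1) \<in> M" using A R by simp
  have "mpowr R (- 1) * R = 1\<^sub>m n"
    using mpowr_mult[OF R, of "- 1" 1] by (simp add: mpowr_one[OF R] mpowr_zero[OF R])
  then have "mpowr R (- 1) * (R * X) = X" if "X \<in> M" for X
    using that R mult_assoc[of "mpowr R (- 1)" R X] by simp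
  then show "mpowr A (- (a / 2)) * mpowr R (- 1) * C = 1\<^sub>m n"
    using A R by (simp add: C_def mult_assoc mpowr_mult mpowr_zero)
qed

lemma C_adjoint: "mat_adjoint C = mpowr A (a / 2) * R"
  using A R by (simp add: C_def adjoint_mult pos_def_adjoint[OF R])

lemma C_mult_adjoint: "C * mat_adjoint C = R * mpowr A a * R"
proof -
  have "C * mat_adjoint C = R * (mpowr A (a / 2) * mpowr A (a / 2)) * R"
    unfolding C_adjoint using A R by (simp add: C_def mult_assoc)
  then show ?thesis by (simp add: mpowr_mult[OF A])
qed

lemma pos_def_adjoint_C: "pos_def n (mat_adjoint C * C)"
  using C_left_inverse pos_def_congruence[OF pos_def_one C_closed] C_closed by auto

text \<open>The outer factors A^(a/2) of C* and C cancel the A^(-a/2) of \<open>inner_mat\<close>,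
  up to cyclicity of the trace; A survives only inside \<open>Y\<close>.\<close>

lemma tr_inner_mat_mult:
  assumes Y: "Y \<in> M"
  shows "tr (inner_mat p a A B * (mat_adjoint C * Y * C)) = tr (R * mpowr B p * R * Y)"
proof -
  have "mpowr A (- (a / 2)) * (mpowr A (a / 2) * X) = X" if "X \<in> M" for X
    using mpowr_cancel[OF A that, of "- (a / 2)"] by simp
  then have "inner_mat p a A B * (mat_adjoint C * Y * C) = mpowr A (- (a / 2)) * (mpowr B p * (R * (Y * (R * mpowr A (a / 2)))))"
    unfolding C_adjoint unfolding C_def using A B R Y by (simp add: mult_assoc)
  also have "mtrace \<dots> = mtrace ((mpowr B p * (R * (Y * (R * mpowr A (a / 2))))) * mpowr A (- (a / 2)))"
    using A B R Y by (intro mtrace_comm) auto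
  also have "(mpowr B p * (R * (Y * (R * mpowr A (a / 2))))) * mpowr A (- (a / 2)) = mpowr B p * (R * (Y * R))"
    using A B R Y by (simp add: mult_assoc mpowr_mult mpowr_zero)
  also have "mtrace \<dots> = mtrace (R * (mpowr B p * (R * Y)))"
    using B R Y mtrace_comm[of "mpowr B p * (R * Y)" R] by (simp add: mult_assoc)
  finally show ?thesis using B R Y by (simp add: mult_assoc)
qed

lemma pos_def_inner_mat: "pos_def n (inner_mat p a A B)"
  using pos_def_sandwich[OF A mpowr_pos_def[OF B]] by simp

lemma tr_adjoint_C: "tr (mat_adjoint C * C) = tr (R * mpowr A a * R)"
  using mtrace_comm[of "mat_adjoint C" C] C_closed by (simp add: C_mult_adjoint)

lemma tr_inner_mat_power:
  "tr (inner_mat p a A B * mpowr (mat_adjoint C * C) (1 - 1 / s)) =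
    tr (R * mpowr B p * R * mpowr (R * mpowr A a * R) (- (1 / s)))"
proof -
  obtain D where D: "D \<in> M" "D * C = 1\<^sub>m n" using C_left_inverse by blast
  have "mpowr (mat_adjoint C * C) (1 - 1 / s) = mat_adjoint C * mpowr (R * mpowr A a * R) (- (1 / s)) * C"
    using mpowr_polar(2)[OF C_closed D, of "- (1 / s)"] by (simp add: C_mult_adjoint)
  moreover have "pos_def n (R * mpowr A a * R)"
    using pos_def_sandwich[OF R mpowr_pos_def[OF A], of 1] by (simp add: mpowr_one[OF R])
  ultimately show ?thesis using tr_inner_mat_mult[of "mpowr (R * mpowr A a * R) (- (1 / s))"] by simp
qed

lemma Phi_eq: "Phi p (- a) s A B = tr (mpowr (inner_mat p a A B) s)"
  by (simp add: Phi_def)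

lemma Phi_ge_Ando_functional:
  "s * tr (R * mpowr B p * R * mpowr (R * mpowr A a * R) (- (1 / s))) - (s - 1) * tr (R * mpowr A a * R)
    \<le> Phi p (- a) s A B"
  using tr_Young[OF pos_def_inner_mat pos_def_adjoint_C s]
  by (simp only: tr_inner_mat_power tr_adjoint_C Phi_eq)

text \<open>Young's inequality at V = (C* C)^k, where the conjugate exponent k = s / (s - 1) is
  chosen to make V^(1-1/s) equal to C* C. The first trace then contains no A at all.\<close>

lemma Phi_ge_Epstein_functional:
  assumes s: "s > 1"
  shows "s * tr (R * mpowr B p * R) - (s - 1) * tr (mpowr (R * mpowr A a * R) (s / (s - 1)))
    \<le> Phi p (- a) s A B"
proof -
  let ?V = "mpowr (mat_adjoint C * C) (s / (s - 1))"
  have e: "s / (s - 1) * (1 - 1 / s) = 1" using s by (simp add: field_simps)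
  have "mpowr ?V (1 - 1 / s) = mat_adjoint C * 1\<^sub>m n * C"
    unfolding mpowr_mpowr[OF pos_def_adjoint_C] e mpowr_one[OF pos_def_adjoint_C] using C_closed by simp
  then have "tr (inner_mat p a A B * mpowr ?V (1 - 1 / s)) = tr (R * mpowr B p * R)"
    using B R by (simp only: tr_inner_mat_mult one_carrier_mat) simp
  moreover have "tr ?V = tr (mpowr (R * mpowr A a * R) (s / (s - 1)))"
    using C_left_inverse mpowr_polar(1)[OF C_closed] by (auto simp: C_mult_adjoint)
  ultimately show ?thesis
    using tr_Young[OF pos_def_inner_mat mpowr_pos_def[OF pos_def_adjoint_C, of "s / (s - 1)"], of s] s
    by (simp add: Phi_eq)
qed

text \<open>This is the equality case V = M^s of Young's inequality: both traces equal
  \<open>Phi\<close>, and s - (s - 1) = 1.\<close>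

lemma Phi_eq_Ando_functional:
  assumes "mat_adjoint C * C = mpowr (inner_mat p a A B) s"
  shows "Phi p (- a) s A B =
    s * tr (R * mpowr B p * R * mpowr (R * mpowr A a * R) (- (1 / s))) - (s - 1) * tr (R * mpowr A a * R)"
proof -
  note X = pos_def_inner_mat
  have "s * (1 - 1 / s) = s - 1" using s by (simp add: field_simps)
  then have "inner_mat p a A B * mpowr (mat_adjoint C * C) (1 - 1 / s) = mpowr (inner_mat p a A B) s"
    unfolding assms mpowr_mpowr[OF X] using mpowr_mult[OF X, of 1 "s - 1"] by (simp add: mpowr_one[OF X])
  then have "tr (R * mpowr B p * R * mpowr (R * mpowr A a * R) (- (1 / s))) = Phi p (- a) s A B"
    by (simp add: Phi_eq flip: tr_inner_mat_power)
  moreover have "tr (R * mpowr A a * R) = Phi p (- a) s A B"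
    by (simp add: Phi_eq assms flip: tr_adjoint_C)
  ultimately show ?thesis by (simp add: algebra_simps)
qed

text \<open>Here V = (C* C)^(s/(s-1)), so the optimal V = M^s corresponds to C* C = M^(s-1).\<close>

lemma Phi_eq_Epstein_functional:
  assumes s: "s > 1" and CC: "mat_adjoint C * C = mpowr (inner_mat p a A B) (s - 1)"
  shows "Phi p (- a) s A B = s * tr (R * mpowr B p * R) - (s - 1) * tr (mpowr (R * mpowr A a * R) (s / (s - 1)))"
proof -
  note X = pos_def_inner_mat
  have "tr (R * mpowr B p * R) = tr (inner_mat p a A B * (mat_adjoint C * 1\<^sub>m n * C))"
    using B R by (simp only: tr_inner_mat_mult one_carrier_mat) simp
  also have "mat_adjoint C * 1\<^sub>m n * C = mpowr (inner_mat p a A B) (s - 1)"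
    using CC C_closed by simp
  also have "inner_mat p a A B * mpowr (inner_mat p a A B) (s - 1) = mpowr (inner_mat p a A B) s"
    using mpowr_mult[OF X, of 1 "s - 1"] by (simp add: mpowr_one[OF X])
  finally have 1: "tr (R * mpowr B p * R) = Phi p (- a) s A B" by (simp add: Phi_eq)
  have "tr (mpowr (R * mpowr A a * R) (s / (s - 1))) = tr (mpowr (mat_adjoint C * C) (s / (s - 1)))"
    using C_left_inverse mpowr_polar(1)[OF C_closed] by (auto simp: C_mult_adjoint)
  also have "\<dots> = Phi p (- a) s A B"
    unfolding CC mpowr_mpowr[OF X] using s by (simp add: Phi_eq)
  finally show ?thesis using 1 by (simp add: algebra_simps)
qed

end

text \<open>Solving A^r R^2 A^r = Q gives R = (A^(-r) Q A^(-r))^(1/2). This supplies the R at which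
  the functionals attain \<open>Phi\<close>.\<close>

lemma ex_congruence_root:
  assumes A: "pos_def n A" and Q: "pos_def n Q"
  shows "\<exists>R. pos_def n R \<and> mat_adjoint (R * mpowr A r) * (R * mpowr A r) = Q"
proof -
  define N where "N = mpowr A (- r) * Q * mpowr A (- r)"
  have N: "pos_def n N" unfolding N_def by (rule pos_def_sandwich[OF A Q])
  define R where "R = mpowr N (1 / 2)"
  have R: "pos_def n R" using N by (simp add: R_def mpowr_pos_def)
  have RR: "R * R = N" by (simp add: R_def mpowr_mult[OF N] mpowr_one[OF N])
  have "mat_adjoint (R * mpowr A r) * (R * mpowr A r) = mpowr A r * (R * R) * mpowr A r"
    using R A by (simp add: adjoint_mult pos_def_adjoint[OF R] mult_assoc)
  also have "\<dots> = mpowr A r * (mpowr A (- r) * (Q * (mpowr A (- r) * mpowr A r)))"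
    unfolding RR N_def using A Q by (simp add: mult_assoc)
  also have "\<dots> = Q"
    using A Q by (simp add: mpowr_cancel mpowr_mult mpowr_zero)
  finally show ?thesis using R by blast
qed

section \<open>Operator concavity of powers, Epstein's theorem and joint convexity\<close>

text \<open>Lieb's theorem with all Z equal to the identity, for every \<open>K\<close>. As
  \<open>mix_le\<close> is an inequality, this combines operator concavity of x^a with its operator
  monotonicity (the case t = 1).\<close>

lemma mix_le_mpowr:
  assumes A: "pos_def n A1" "pos_def n A2" "pos_def n A" and t: "0 \<le> t" "t \<le> 1"
    and mA: "mix_le t A1 A2 A" and a: "0 \<le> a" "a \<le> 1"
  shows "mix_le t (mpowr A1 a) (mpowr A2 a) (mpowr A a)"
  unfolding mix_le_def
proof
  fix K assume K: "K \<in> M"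
  show "t * tr (mat_adjoint K * mpowr A1 a * K) + (1 - t) * tr (mat_adjoint K * mpowr A2 a * K)
    \<le> tr (mat_adjoint K * mpowr A a * K)"
    using Lieb_concavity[OF A pos_def_one pos_def_one pos_def_one t mix_le_refl K mA a] A K
    by (simp add: one_mpowr)
qed

text \<open>Z = W^k attains equality in Young's inequality with exponent k. Lieb's theorem bounds
  the mixture of the tr (W Z^(1-1/k)) by tr (W(A) Y^(1-1/k)) with Y the mixture of the Z; Young
  bounds k times the latter by tr Z(A) + (k - 1) tr Y. Since tr Y is the mixture of the traces, k -
  1 copies of it cancel.\<close>

lemma Epstein_concavity:
  assumes A: "pos_def n A1" "pos_def n A2" "pos_def n A" and t: "0 \<le> t" "t \<le> 1"
    and mA: "mix_le t A1 A2 A" and R: "pos_def n R" and a: "0 \<le> a" "a < 1" and k: "1 < k" "1 - 1 / k \<le> 1 - a"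
  shows "t * tr (mpowr (R * mpowr A1 a * R) k) + (1 - t) * tr (mpowr (R * mpowr A2 a * R) k)
    \<le> tr (mpowr (R * mpowr A a * R) k)"
proof -
  define W where "W X = R * mpowr X a * R" for X
  define Z where "Z X = mpowr (W X) k" for X
  have W: "pos_def n (W X)" if "pos_def n X" for X
    using pos_def_sandwich[OF R mpowr_pos_def[OF that], of 1 a] by (simp add: mpowr_one[OF R] W_def)
  have Z: "pos_def n (Z X)" if "pos_def n X" for X
    using W[OF that] by (simp add: Z_def mpowr_pos_def)
  define Y where "Y = mix t (Z A1) (Z A2)"
  have Y: "pos_def n Y" unfolding Y_def by (intro pos_def_convex Z A t)
  \<comment> \<open>Writing Y^(1-1/k) as (Y^th)^(1-a) gives Lieb's theorem its exponents a and 1 -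
    a; the bound on k makes th <= 1.\<close>
  define th where "th = (1 - 1 / k) / (1 - a)"
  have th: "0 \<le> th" "th \<le> 1" "th * (1 - a) = 1 - 1 / k"
    using a k by (auto simp: th_def)
  have mY: "mix_le t (Z A1) (Z A2) Y"
    unfolding Y_def using Z A by (intro mix_le_mix) auto
  have mth: "mix_le t (mpowr (Z A1) th) (mpowr (Z A2) th) (mpowr Y th)"
    by (intro mix_le_mpowr Z A Y t mY th)
  have L: "t * tr (mat_adjoint R * mpowr A1 a * R * mpowr (mpowr (Z A1) th) (1 - a)) +
      (1 - t) * tr (mat_adjoint R * mpowr A2 a * R * mpowr (mpowr (Z A2) th) (1 - a))
      \<le> tr (mat_adjoint R * mpowr A a * R * mpowr (mpowr Y th) (1 - a))"
    using a by (intro Lieb_concavity A mpowr_pos_def Z Y t mth mA) (use R in auto)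
  have self: "W X * mpowr (Z X) (1 - 1 / k) = Z X" if "pos_def n X" for X
  proof -
    have "W X * mpowr (Z X) (1 - 1 / k) = mpowr (W X) 1 * mpowr (W X) (k - 1)"
      unfolding Z_def mpowr_mpowr[OF W[OF that]] using k
      by (simp add: mpowr_one[OF W[OF that]] right_diff_distrib)
    then show ?thesis unfolding mpowr_mult[OF W[OF that]] by (simp add: Z_def)
  qed
  have "k * (t * tr (Z A1) + (1 - t) * tr (Z A2)) \<le> k * tr (W A * mpowr Y (1 - 1 / k))"
    using L Y k by (simp add: mpowr_mpowr Z A th(3) pos_def_adjoint[OF R] self flip: W_def)
  also have "\<dots> \<le> tr (Z A) + (k - 1) * tr Y"
    unfolding Z_def[of A] using tr_Young[OF W[OF A(3)] Y, of k] k by simp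
  also have "tr Y = t * tr (Z A1) + (1 - t) * tr (Z A2)"
    unfolding Y_def using Z A by (intro tr_mix) auto
  finally have "t * tr (Z A1) + (1 - t) * tr (Z A2) \<le> tr (Z A)"
    by (simp add: algebra_simps)
  then show ?thesis by (simp add: Z_def W_def)
qed

text \<open>R is chosen optimal for the mixed pair (A, B). The functional equals \<open>Phi\<close>
  there, and the same R gives lower bounds for \<open>Phi\<close> at both end points.\<close>

lemma Phi_convex:
  assumes A1: "pos_def n A1" and B1: "pos_def n B1" and A2: "pos_def n A2" and B2: "pos_def n B2"
    and t: "0 \<le> t" "t \<le> 1" and p: "1 \<le> p" "p \<le> 2" and a: "0 < a" "a \<le> 1"
    and s: "p \<noteq> 1 \<and> s \<ge> 1 / (p - 1) \<or> a \<noteq> 1 \<and> s \<ge> 1 / (1 - a)"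
  shows "Phi p (- a) s (mix t A1 A2) (mix t B1 B2)
    \<le> t * Phi p (- a) s A1 B1 + (1 - t) * Phi p (- a) s A2 B2"
proof -
  define A where "A = mix t A1 A2"
  define B where "B = mix t B1 B2"
  have A: "pos_def n A" and B: "pos_def n B"
    unfolding A_def B_def by (intro pos_def_convex A1 A2 B1 B2 t)+
  have mA: "mix_le t A1 A2 A" unfolding A_def using A1 A2 by (intro mix_le_mix) auto
  have mAa: "mix_le t (mpowr A1 a) (mpowr A2 a) (mpowr A a)"
    using mix_le_mpowr[OF A1 A2 A t mA] a by simp
  note X = pos_def_sandwich[OF A mpowr_pos_def[OF B, of p], of "- (a / 2)"]
  from s show ?thesis
  proof (elim disjE conjE)
    assume p1: "p \<noteq> 1" and sp: "s \<ge> 1 / (p - 1)"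
    \<comment> \<open>p <= 2 forces s >= 1, as Young's inequality demands.\<close>
    have "1 / (p - 1) \<ge> 1" using p p1 by simp
    then have s: "s \<ge> 1" using sp by simp
    obtain R where R: "pos_def n R"
      and CC: "mat_adjoint (R * mpowr A (a / 2)) * (R * mpowr A (a / 2)) = mpowr (inner_mat p a A B) s"
      using ex_congruence_root[OF A mpowr_pos_def[OF X, of s], of "a / 2"] by blast
    have Ra: "mat_adjoint R = R" by (rule pos_def_adjoint[OF R])
    define W where "W X = R * mpowr X a * R" for X
    have W: "pos_def n (W X)" if "pos_def n X" for X
      using pos_def_sandwich[OF R mpowr_pos_def[OF that], of 1 a] by (simp add: mpowr_one[OF R] W_def)
    have mW: "mix_le t (W A1) (W A2) (W A)"
      using mix_le_congruence[OF mAa, of R] A1 A2 A R by (simp add: W_def Ra)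
    \<comment> \<open>The exponent with (W^th)^(1-p) = W^(-1/s), which fits Ando's theorem; th <= 1
      is the hypothesis on s.\<close>
    define th where "th = 1 / (s * (p - 1))"
    have "s * (p - 1) \<ge> 1" using sp p p1 by (simp add: field_simps)
    then have th: "0 \<le> th" "th \<le> 1" "th * (1 - p) = - (1 / s)"
      using s p p1 by (auto simp: th_def field_simps)
    have mth: "mix_le t (mpowr (W A1) th) (mpowr (W A2) th) (mpowr (W A) th)"
      by (intro mix_le_mpowr W A1 A2 A t mW th)
    let ?T = "\<lambda>A B. tr (R * mpowr B p * R * mpowr (W A) (- (1 / s)))"
    have "tr (mat_adjoint R * mpowr B p * R * mpowr (mpowr (W A) th) (1 - p))
      \<le> t * tr (mat_adjoint R * mpowr B1 p * R * mpowr (mpowr (W A1) th) (1 - p)) +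
        (1 - t) * tr (mat_adjoint R * mpowr B2 p * R * mpowr (mpowr (W A2) th) (1 - p))"
      by (intro Ando_convexity B1 B2 B mpowr_pos_def W A1 A2 A t mth B_def p) (use R in auto)
    then have T: "?T A B \<le> t * ?T A1 B1 + (1 - t) * ?T A2 B2"
      by (simp only: mpowr_mpowr[OF W] A A1 A2 th(3) Ra)
    have tW: "t * tr (W A1) + (1 - t) * tr (W A2) \<le> tr (W A)"
      using mix_le_tr[OF mW] W A1 A2 A by simp
    have "Phi p (- a) s A B = s * ?T A B - (s - 1) * tr (W A)"
      unfolding W_def by (rule Phi_eq_Ando_functional[OF A B R s refl CC])
    \<comment> \<open>The concave trace enters with the nonpositive factor -(s - 1), so the
      functional is convex.\<close>
    also have "\<dots> \<le> s * (t * ?T A1 B1 + (1 - t) * ?T A2 B2) - (s - 1) * (t * tr (W A1) + (1 - t) * tr (W A2))"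
      using T tW s by (intro diff_mono mult_left_mono) auto
    also have "\<dots> = t * (s * ?T A1 B1 - (s - 1) * tr (W A1)) + (1 - t) * (s * ?T A2 B2 - (s - 1) * tr (W A2))"
      by (simp add: algebra_simps)
    also have "\<dots> \<le> t * Phi p (- a) s A1 B1 + (1 - t) * Phi p (- a) s A2 B2"
      using Phi_ge_Ando_functional[OF A1 B1 R s refl, of p a] Phi_ge_Ando_functional[OF A2 B2 R s refl, of p a] t
      unfolding W_def by (intro add_mono mult_left_mono) auto
    finally show ?thesis by (simp only: A_def B_def)
  next
    assume a1: "a \<noteq> 1" and sa: "s \<ge> 1 / (1 - a)"
    \<comment> \<open>a > 0 makes the inequality strict, so that the conjugate exponent s / (s - 1)
      exists.\<close>
    have "1 / (1 - a) > 1" using a a1 by simp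
    then have s1: "s > 1" using sa by linarith
    then have s: "s \<ge> 1" by simp
    define k where "k = s / (s - 1)"
    \<comment> \<open>As 1 - 1/k = 1/s, the condition of Epstein's theorem becomes 1/s <= 1 -
      a.\<close>
    have k: "1 < k" "1 - 1 / k = 1 / s" using s1 by (auto simp: k_def field_simps)
    have sa': "1 / s \<le> 1 - a" using sa s1 a a1 by (simp add: field_simps)
    obtain R where R: "pos_def n R"
      and CC: "mat_adjoint (R * mpowr A (a / 2)) * (R * mpowr A (a / 2)) = mpowr (inner_mat p a A B) (s - 1)"
      using ex_congruence_root[OF A mpowr_pos_def[OF X, of "s - 1"], of "a / 2"] by blast
    have Ra: "mat_adjoint R = R" by (rule pos_def_adjoint[OF R])
    let ?T = "\<lambda>B. tr (R * mpowr B p * R)"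
    let ?W = "\<lambda>A. tr (mpowr (R * mpowr A a * R) k)"
    \<comment> \<open>With Z the identity, Ando's theorem becomes convexity of B^p under the trace,
      for all p from 1 to 2.\<close>
    have "tr (mat_adjoint R * mpowr B p * R * mpowr (1\<^sub>m n) (1 - p))
      \<le> t * tr (mat_adjoint R * mpowr B1 p * R * mpowr (1\<^sub>m n) (1 - p)) +
        (1 - t) * tr (mat_adjoint R * mpowr B2 p * R * mpowr (1\<^sub>m n) (1 - p))"
      by (intro Ando_convexity B1 B2 B pos_def_one t mix_le_refl B_def p) (use R in auto)
    then have T: "?T B \<le> t * ?T B1 + (1 - t) * ?T B2"
      using B B1 B2 R by (simp add: one_mpowr Ra)
    have tW: "t * ?W A1 + (1 - t) * ?W A2 \<le> ?W A"
      using Epstein_concavity[OF A1 A2 A t mA R, of a k] a a1 k sa' by simp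
    have "Phi p (- a) s A B = s * ?T B - (s - 1) * ?W A"
      unfolding k_def by (rule Phi_eq_Epstein_functional[OF A B R s refl s1 CC])
    also have "\<dots> \<le> s * (t * ?T B1 + (1 - t) * ?T B2) - (s - 1) * (t * ?W A1 + (1 - t) * ?W A2)"
      using T tW s by (intro diff_mono mult_left_mono) auto
    also have "\<dots> = t * (s * ?T B1 - (s - 1) * ?W A1) + (1 - t) * (s * ?T B2 - (s - 1) * ?W A2)"
      by (simp add: algebra_simps)
    also have "\<dots> \<le> t * Phi p (- a) s A1 B1 + (1 - t) * Phi p (- a) s A2 B2"
      using Phi_ge_Epstein_functional[OF A1 B1 R s refl s1, of p a] Phi_ge_Epstein_functional[OF A2 B2 R s refl s1, of p a] t
      unfolding k_def by (intro add_mono mult_left_mono) auto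
    finally show ?thesis by (simp only: A_def B_def)
  qed
qed

end

text \<open>Being at least a minimum is a disjunction. In HOL \<open>1 / 0 = 0\<close>, so the
  guards \<open>p \<noteq> 1\<close> and \<open>q \<noteq> -1\<close> encode the convention that the
  corresponding bound is infinite.\<close>

theorem theorem4p1:
  fixes p q s :: real and n :: nat
  assumes "1 \<le> p" "p \<le> 2" "-1 \<le> q" "q < 0"
    and "(p \<noteq> 1 \<and> s \<ge> 1 / (p - 1)) \<or> (q \<noteq> -1 \<and> s \<ge> 1 / (1 + q))"
  shows "\<forall>A1 B1 A2 B2 t. pos_def n A1 \<and> pos_def n B1 \<and> pos_def n A2 \<and> pos_def n B2
           \<and> 0 \<le> t \<and> t \<le> 1 \<longrightarrow>
         Phi p q s (t \<cdot>\<^sub>m A1 + (1 - t) \<cdot>\<^sub>m A2) (t \<cdot>\<^sub>m B1 + (1 - t) \<cdot>\<^sub>m B2)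
           \<le> t * Phi p q s A1 B1 + (1 - t) * Phi p q s A2 B2"
  using square_mats.Phi_convex[where n = n and p = p and a = "- q" and s = s] assms
  by auto

end
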